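(* Let $T\in\mathcal{L}(H)$ have the polar decomposition $T=U|T|$. Then for each $n\in\mathbb{N}$, the following statements are equivalent: (i) $T$ is $(n+1)$-centered; (ii) $\big[U^k|T|(U^k)^*,\,|T|\big]=0$ for $1\le k\le n$.
   Context: $\mathbb{N}$ is the set of positive integers. $\mathfrak{A}$ is a $C^*$-algebra, $H$ is a (right) Hilbert $\mathfrak{A}$-module, and $\mathcal{L}(H)$ is the $C^*$-algebra of adjointable operators on $H$. $[A,B]=AB-BA$. For $T\in\mathcal{L}(H)$, $|T|=(T^*T)^{1/2}$, and $\mathcal{R}(T)$ is the range of $T$. A closed submodule $M\subseteq H$ is orthogonally complemented if $H=M\dotplus M^\perp$; then $P_M$ denotes the projection from $H$ onto $M$. An element $W\in\mathcal{L}(H)$ is a partial isometry if $W^*W$ is a projection. "$T=U|T|$ is the polar decomposition of $T$" means: $U\in\mathcal{L}(H)$ is a partial isometry, $T=U|T|$, $\overline{\mathcal{R}(T^* )}$ is orthogonally complemented, and $U^*U=P_{\overline{\mathcal{R}(T^* )}}$. (Such a $U$ is unique when it exists, and it exists if and only if both $\overline{\mathcal{R}(T^* )}$ and $\overline{\mathcal{R}(T)}$ are orthogonally complemented.) If $T$ has the polar decomposition $T=U|T|$ and $n\in\mathbb{N}$, then $T$ is called $n$-centered if $T^k=U^k|T^k|$ is the polar decomposition of $T^k$ for $k=1,2,\dots,n$. *)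

theory Defs
  imports "HOL-Analysis.Analysis"
begin

class complex_banach = banach +
  fixes cscale :: "complex \<Rightarrow> 'a \<Rightarrow> 'a"
  assumes cscale_add_right: "cscale c (x + y) = cscale c x + cscale c y"
    and cscale_add_left: "cscale (c + d) x = cscale c x + cscale d x"
    and cscale_cscale: "cscale c (cscale d x) = cscale (c * d) x"
    and scaleR_cscale: "scaleR r x = cscale (complex_of_real r) x"
    and norm_cscale: "norm (cscale c x) = cmod c * norm x"

text \<open>The algebra need not be unital and may be zero.\<close>

class cstar_algebra = complex_banach + real_normed_algebra +
  fixes star :: "'a \<Rightarrow> 'a"
  assumes cscale_mult_left: "cscale c x * y = cscale c (x * y)"
    and cscale_mult_right: "x * cscale c y = cscale c (x * y)"
    and star_add: "star (x + y) = star x + star y"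
    and star_cscale: "star (cscale c x) = cscale (cnj c) (star x)"
    and star_mult: "star (x * y) = star y * star x"
    and star_star: "star (star x) = x"
    and cstar_identity: "norm (star x * x) = (norm x)\<^sup>2"

definition cstar_positive :: "'a::cstar_algebra \<Rightarrow> bool" where
  "cstar_positive a \<longleftrightarrow> (\<exists>b. a = star b * b)"

text \<open>
  Right Hilbert modules, with the inner product linear in the second argument.
  The type class on \<open>'h\<close> supplies complex scalars and completeness; the last assumption
  identifies its norm with the one induced by the inner product.
\<close>

locale hilbert_module =
  fixes act :: "'h::complex_banach \<Rightarrow> 'a::cstar_algebra \<Rightarrow> 'h"
    and ip :: "'h \<Rightarrow> 'h \<Rightarrow> 'a"
  assumes act_add_left: "act (x + y) a = act x a + act y a"
    and act_add_right: "act x (a + b) = act x a + act x b"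
    and act_act: "act (act x a) b = act x (a * b)"
    and act_cscale_left: "act (cscale c x) a = cscale c (act x a)"
    and act_cscale_right: "act x (cscale c a) = cscale c (act x a)"
    and ip_add_right: "ip x (y + z) = ip x y + ip x z"
    and ip_cscale_right: "ip x (cscale c y) = cscale c (ip x y)"
    and ip_act_right: "ip x (act y a) = ip x y * a"
    and ip_star: "ip y x = star (ip x y)"
    and ip_positive: "cstar_positive (ip x x)"
    and ip_definite: "ip x x = 0 \<Longrightarrow> x = 0"
    and norm_eq_sqrt_ip: "norm x = sqrt (norm (ip x x))"

text \<open>
  The definitions below are meaningful when \<open>act\<close> and \<open>ip\<close> form a Hilbert module. Adjointable
  maps are then automatically linear and bounded.
\<close>

definition adjointable :: "('h \<Rightarrow> 'h \<Rightarrow> 'a) \<Rightarrow> ('h \<Rightarrow> 'h) \<Rightarrow> bool" where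
  "adjointable ip T \<longleftrightarrow> (\<exists>S. \<forall>x y. ip (T x) y = ip x (S y))"

definition adj :: "('h \<Rightarrow> 'h \<Rightarrow> 'a) \<Rightarrow> ('h \<Rightarrow> 'h) \<Rightarrow> ('h \<Rightarrow> 'h)" where
  "adj ip T = (THE S. \<forall>x y. ip (T x) y = ip x (S y))"

text \<open>Positivity in the C*-algebra of adjointable operators, as in \<^const>\<open>cstar_positive\<close>.\<close>

definition op_positive :: "('h \<Rightarrow> 'h \<Rightarrow> 'a) \<Rightarrow> ('h \<Rightarrow> 'h) \<Rightarrow> bool" where
  "op_positive ip A \<longleftrightarrow> (\<exists>B. adjointable ip B \<and> A = adj ip B \<circ> B)"

definition op_abs :: "('h \<Rightarrow> 'h \<Rightarrow> 'a) \<Rightarrow> ('h \<Rightarrow> 'h) \<Rightarrow> ('h \<Rightarrow> 'h)" where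
  "op_abs ip T = (THE A. op_positive ip A \<and> A \<circ> A = adj ip T \<circ> T)"

definition commutator :: "('h::ab_group_add \<Rightarrow> 'h) \<Rightarrow> ('h \<Rightarrow> 'h) \<Rightarrow> ('h \<Rightarrow> 'h)" where
  "commutator A B = (\<lambda>x. A (B x) - B (A x))"

definition op_projection :: "('h \<Rightarrow> 'h \<Rightarrow> 'a) \<Rightarrow> ('h \<Rightarrow> 'h) \<Rightarrow> bool" where
  "op_projection ip P \<longleftrightarrow> adjointable ip P \<and> adj ip P = P \<and> P \<circ> P = P"

definition partial_isometry :: "('h \<Rightarrow> 'h \<Rightarrow> 'a) \<Rightarrow> ('h \<Rightarrow> 'h) \<Rightarrow> bool" where
  "partial_isometry ip W \<longleftrightarrow> adjointable ip W \<and> op_projection ip (adj ip W \<circ> W)"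

definition closed_submodule ::
    "('h::complex_banach \<Rightarrow> 'a \<Rightarrow> 'h) \<Rightarrow> 'h set \<Rightarrow> bool" where
  "closed_submodule act M \<longleftrightarrow> closed M \<and> 0 \<in> M \<and> (\<forall>x\<in>M. \<forall>y\<in>M. x + y \<in> M) \<and>
     (\<forall>c. \<forall>x\<in>M. cscale c x \<in> M) \<and> (\<forall>a. \<forall>x\<in>M. act x a \<in> M)"

definition ortho :: "('h \<Rightarrow> 'h \<Rightarrow> 'a::zero) \<Rightarrow> 'h set \<Rightarrow> 'h set" where
  "ortho ip M = {y. \<forall>x\<in>M. ip x y = 0}"

definition orth_complemented ::
    "('h::complex_banach \<Rightarrow> 'a::zero \<Rightarrow> 'h) \<Rightarrow> ('h \<Rightarrow> 'h \<Rightarrow> 'a) \<Rightarrow> 'h set \<Rightarrow> bool" where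
  "orth_complemented act ip M \<longleftrightarrow> closed_submodule act M \<and>
     (\<forall>x. \<exists>y\<in>M. \<exists>z\<in>ortho ip M. x = y + z) \<and> M \<inter> ortho ip M = {0}"

definition proj_onto :: "('h::minus \<Rightarrow> 'h \<Rightarrow> 'a::zero) \<Rightarrow> 'h set \<Rightarrow> 'h \<Rightarrow> 'h" where
  "proj_onto ip M x = (THE y. y \<in> M \<and> x - y \<in> ortho ip M)"

definition polar_decomposition ::
    "('h::complex_banach \<Rightarrow> 'a::zero \<Rightarrow> 'h) \<Rightarrow> ('h \<Rightarrow> 'h \<Rightarrow> 'a) \<Rightarrow> ('h \<Rightarrow> 'h) \<Rightarrow> ('h \<Rightarrow> 'h) \<Rightarrow> bool" where
  "polar_decomposition act ip T U \<longleftrightarrow>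
     partial_isometry ip U \<and> T = U \<circ> op_abs ip T \<and>
     orth_complemented act ip (closure (range (adj ip T))) \<and>
     adj ip U \<circ> U = proj_onto ip (closure (range (adj ip T)))"

text \<open>The partial isometry \<open>U\<close> is uniquely determined by \<open>T\<close>.\<close>

definition n_centered ::
    "('h::complex_banach \<Rightarrow> 'a::zero \<Rightarrow> 'h) \<Rightarrow> ('h \<Rightarrow> 'h \<Rightarrow> 'a) \<Rightarrow> nat \<Rightarrow> ('h \<Rightarrow> 'h) \<Rightarrow> bool" where
  "n_centered act ip n T \<longleftrightarrow>
     (\<exists>U. polar_decomposition act ip T U \<and>
          (\<forall>k\<in>{1..n}. polar_decomposition act ip (T ^^ k) (U ^^ k)))"

end

theory Submission
  imports Defs
begin

text \<open>
  Write \<open>A = |T|\<close>. The theorem rests on the polar decomposition of a product. Let \<open>S = V |S|\<close>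
  and \<open>T = U |T|\<close> be polar decompositions and put \<open>G = V |S| V\<^sup>*\<close>, which is \<open>|S\<^sup>*|\<close>. Then
  \<open>(U V) |T S|\<close> is the polar decomposition of \<open>T S\<close> if and only if \<open>A\<close> and \<open>G\<close> commute
  (\<open>polar_factors_comp\<close>, \<open>polar_factors_comp_converse\<close>), and in that case the operator that belongs
  to \<open>T S\<close> as \<open>G\<close> belongs to \<open>S\<close> is \<open>U A G U\<^sup>*\<close>. Taking \<open>S = T\<^sup>k\<close> and \<open>V = U\<^sup>k\<close>, the operator
  \<open>T\<close> is \<open>(n + 1)\<close>-centered exactly when \<open>A\<close> commutes with \<open>G\<^sub>k = U\<^sup>k |T\<^sup>k| (U\<^sup>*)\<^sup>k\<close> for
  \<open>1 \<le> k \<le> n\<close>.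

  It remains to pass from \<open>G\<^sub>k\<close> to \<open>A\<^sub>k = U\<^sup>k A (U\<^sup>*)\<^sup>k\<close>. An operator that commutes with \<open>A\<close> also
  commutes with the projection \<open>U\<^sup>* U\<close> onto the closed range of \<open>A\<close>, and on such operators
  \<open>Z \<mapsto> U Z U\<^sup>*\<close> is multiplicative. So as long as \<open>A\<^sub>1, \<dots>, A\<^sub>k\<close> commute with \<open>A\<close>, the recursion
  \<open>G\<^bsub>k+1\<^esub> = U A G\<^sub>k U\<^sup>*\<close> gives \<open>G\<^bsub>k+1\<^esub> = A\<^sub>1 \<cdots> A\<^bsub>k+1\<^esub>\<close> (\<open>conj_prod_shift\<close>). One direction is now
  immediate. For the other, if \<open>G\<^sub>m\<close> and \<open>G\<^bsub>m+1\<^esub> = G\<^sub>m A\<^bsub>m+1\<^esub>\<close> commute with \<open>A\<close>, then \<open>G\<^sub>m\<close> annihilates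
  the commutator of \<open>A\<close> and \<open>A\<^bsub>m+1\<^esub>\<close>. The range of this commutator lies in the closed range of
  \<open>G\<^sub>m\<close>, where \<open>G\<^sub>m\<close> is injective, so the commutator vanishes (\<open>conj_pow_commutes\<close>).

  All this presupposes that adjointable operators have absolute values: the positive operator
  \<open>T\<^sup>* T\<close> must have exactly one positive square root, and the root must commute with everything
  that commutes with \<open>T\<^sup>* T\<close>. This is developed from the axioms without spectral theory. Positivity
  of a self-adjoint \<open>p\<close> is taken to mean \<open>\<parallel>r - p\<parallel> \<le> r\<close> for some \<open>r\<close>, which is visibly additive
  and makes the classical iteration for square roots converge. That \<open>T\<^sup>* T\<close> is positive in this
  sense (\<open>pos_adj_comp\<close>) is the theorem of Fukamiya and Kelley--Vaught, proved here along
  Kaplansky's lines.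
\<close>

section \<open>Sesquilinear algebra in a Hilbert module\<close>

lemma cscale_one [simp]: "cscale 1 x = (x::'a::complex_banach)"
  by (metis scaleR_cscale of_real_1 scaleR_one)

lemma cscale_zero_right [simp]: "cscale c 0 = (0::'a::complex_banach)"
  by (metis add_cancel_right_left cscale_add_right add_0)

lemma cscale_zero_left [simp]: "cscale 0 x = (0::'a::complex_banach)"
  by (metis of_real_0 scaleR_cscale scaleR_zero_left)

lemma cscale_minus_right: "cscale c (- x) = - cscale c (x::'a::complex_banach)"
  by (metis add.inverse_unique add.right_inverse cscale_add_right cscale_zero_right)

lemma cscale_minus_left: "cscale (- c) x = - cscale c (x::'a::complex_banach)"
  by (metis add.inverse_unique add.right_inverse cscale_add_left cscale_zero_left)

lemma cscale_diff_right: "cscale c (x - y) = cscale c x - cscale c (y::'a::complex_banach)"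
  by (metis cscale_add_right cscale_minus_right diff_conv_add_uminus)

lemma star_scaleR: "star (r *\<^sub>R x) = r *\<^sub>R star (x::'a::cstar_algebra)"
  by (simp add: scaleR_cscale star_cscale)

lemma norm_star [simp]: "norm (star x) = norm (x::'a::cstar_algebra)"
proof -
  have le: "norm y \<le> norm (star y)" for y :: 'a
  proof (cases "y = 0")
    case False
    have "norm y * norm y \<le> norm (star y) * norm y"
      using norm_mult_ineq[of "star y" y] by (simp add: cstar_identity power2_eq_square)
    with False show ?thesis by simp
  qed simp
  show ?thesis using le[of x] le[of "star x"] by (simp add: star_star)
qed

text \<open>The relational form of the adjoint lets the algebra of adjoints be computed before their
  uniqueness is used.\<close>

definition (in hilbert_module) adjp :: "('h \<Rightarrow> 'h) \<Rightarrow> ('h \<Rightarrow> 'h) \<Rightarrow> bool" where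
  "adjp T S \<longleftrightarrow> (\<forall>x y. ip (T x) y = ip x (S y))"

context hilbert_module
begin

abbreviation self_adjoint :: "('h \<Rightarrow> 'h) \<Rightarrow> bool" where
  "self_adjoint P \<equiv> adjp P P"

lemma ip_add_left: "ip (x + y) z = ip x z + ip y z"
  by (metis ip_add_right ip_star star_add)

lemma ip_cscale_left: "ip (cscale c x) y = cscale (cnj c) (ip x y)"
  by (metis ip_cscale_right ip_star star_cscale)

lemma ip_scaleR_right: "ip x (r *\<^sub>R y) = r *\<^sub>R ip x y"
  by (simp add: scaleR_cscale ip_cscale_right)

lemma ip_scaleR_left: "ip (r *\<^sub>R x) y = r *\<^sub>R ip x y"
  by (simp add: scaleR_cscale ip_cscale_left)

lemma ip_diff_right: "ip x (y - z) = ip x y - ip x z"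
  by (metis add_diff_cancel ip_add_right diff_add_cancel)

lemma ip_diff_left: "ip (y - z) x = ip y x - ip z x"
  by (metis add_diff_cancel ip_add_left diff_add_cancel)

lemma ip_zero_right [simp]: "ip x 0 = 0"
  by (metis diff_self ip_diff_right)

lemma ip_zero_left [simp]: "ip 0 x = 0"
  by (metis diff_self ip_diff_left)

lemma ip_act_left: "ip (act x a) y = star a * ip x y"
  by (metis ip_act_right ip_star star_mult)

lemma norm_ip_self: "norm (ip x x) = (norm x)\<^sup>2"
  by (simp add: norm_eq_sqrt_ip)

lemma eq_if_ip_eq: "(\<And>z. ip z x = ip z y) \<Longrightarrow> x = y"
  by (metis eq_iff_diff_eq_0 ip_definite ip_diff_right)

lemma adjpD: "adjp T S \<Longrightarrow> ip (T x) y = ip x (S y)"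
  by (simp add: adjp_def)

lemma adjpI: "(\<And>x y. ip (T x) y = ip x (S y)) \<Longrightarrow> adjp T S"
  by (simp add: adjp_def)

lemma adjp_sym: "adjp T S \<Longrightarrow> adjp S T"
  unfolding adjp_def by (metis ip_star)

lemma adjp_unique: "adjp T S \<Longrightarrow> adjp T S' \<Longrightarrow> S = S'"
  by (rule ext, rule eq_if_ip_eq) (simp add: adjpD[symmetric])

lemma adj_eqI: "adjp T S \<Longrightarrow> adj ip T = S"
  unfolding adj_def adjp_def[symmetric] by (rule the_equality) (simp_all add: adjp_unique)

lemma adjp_adj: "adjointable ip T \<Longrightarrow> adjp T (adj ip T)"
  unfolding adjointable_def adjp_def[symmetric] using adj_eqI by blast

lemma adjointableI: "adjp T S \<Longrightarrow> adjointable ip T"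
  unfolding adjointable_def adjp_def by blast

lemma adjp_comp: "adjp T T' \<Longrightarrow> adjp S S' \<Longrightarrow> adjp (\<lambda>x. T (S x)) (\<lambda>x. S' (T' x))"
  unfolding adjp_def by simp

lemma adjp_id: "adjp (\<lambda>x. x) (\<lambda>x. x)"
  unfolding adjp_def by simp

lemma adjp_add: "adjp T T' \<Longrightarrow> adjp S S' \<Longrightarrow> adjp (\<lambda>x. T x + S x) (\<lambda>x. T' x + S' x)"
  unfolding adjp_def by (simp add: ip_add_left ip_add_right)

lemma adjp_diff: "adjp T T' \<Longrightarrow> adjp S S' \<Longrightarrow> adjp (\<lambda>x. T x - S x) (\<lambda>x. T' x - S' x)"
  unfolding adjp_def by (simp add: ip_diff_left ip_diff_right)

lemma adjp_scaleR: "adjp T T' \<Longrightarrow> adjp (\<lambda>x. r *\<^sub>R T x) (\<lambda>x. r *\<^sub>R T' x)"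
  unfolding adjp_def by (simp add: ip_scaleR_left ip_scaleR_right)

lemma adjp_cscale: "adjp T T' \<Longrightarrow> adjp (\<lambda>x. cscale c (T x)) (\<lambda>x. cscale (cnj c) (T' x))"
  unfolding adjp_def by (simp add: ip_cscale_left ip_cscale_right)

lemma adjp_funpow: "adjp T S \<Longrightarrow> adjp (T ^^ k) (S ^^ k)"
proof (induction k)
  case (Suc k)
  then show ?case unfolding adjp_def by (simp add: funpow_swap1)
qed (simp add: adjp_def)

text \<open>Adjointable maps are automatically linear over the scalars and over the algebra, because
  the inner product separates points.\<close>

lemma adjp_map_add: "adjp T S \<Longrightarrow> T (x + y) = T x + T y"
  by (rule eq_if_ip_eq) (simp add: adjpD[OF adjp_sym, symmetric] ip_add_right)

lemma adjp_map_diff: "adjp T S \<Longrightarrow> T (x - y) = T x - T y"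
  by (rule eq_if_ip_eq) (simp add: adjpD[OF adjp_sym, symmetric] ip_diff_right)

lemma adjp_map_cscale: "adjp T S \<Longrightarrow> T (cscale c x) = cscale c (T x)"
  by (rule eq_if_ip_eq) (simp add: adjpD[OF adjp_sym, symmetric] ip_cscale_right)

lemma adjp_map_scaleR: "adjp T S \<Longrightarrow> T (r *\<^sub>R x) = r *\<^sub>R T x"
  by (simp add: scaleR_cscale adjp_map_cscale)

lemma adjp_map_act: "adjp T S \<Longrightarrow> T (act x a) = act (T x) a"
  by (rule eq_if_ip_eq) (simp add: adjpD[OF adjp_sym, symmetric] ip_act_right)

lemma adjp_map_zero: "adjp T S \<Longrightarrow> T 0 = 0"
  by (metis adjp_map_diff diff_self)

lemmas adjp_linear = adjp_map_add adjp_map_diff adjp_map_cscale adjp_map_scaleR adjp_map_zero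

lemma zero_if_adj_comp_zero: "adjp T S \<Longrightarrow> S (T x) = 0 \<Longrightarrow> T x = 0"
  by (metis adjpD ip_definite ip_zero_right)

text \<open>The operators \<open>w \<plusminus> i s\<close> for commuting self-adjoint \<open>w\<close> and \<open>s\<close> satisfy
  \<open>(w \<plusminus> i s)\<^sup>* (w \<plusminus> i s) = w\<^sup>2 + s\<^sup>2\<close>. Their norms are thus governed by \<open>w\<^sup>2 + s\<^sup>2\<close>, and \<open>s\<close> is a
  combination of the two. This replaces a comparison of norms of positive elements.\<close>

lemma norm_le_sum_of_squares:
  assumes w: "self_adjoint w" and s: "self_adjoint s" and comm: "\<And>x. w (s x) = s (w x)"
  shows "(norm (s x))\<^sup>2 \<le> norm (ip x (w (w x) + s (s x)))"
proof -
  define N where "N = norm (ip x (w (w x) + s (s x)))"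
  have ws: "ip (w x) (s x) = ip (s x) (w x)"
    using adjpD[OF w, of x "s x"] adjpD[OF s, of x "w x"] comm by simp
  have "ip (w x + cscale \<i> (s x)) (w x + cscale \<i> (s x)) = ip x (w (w x) + s (s x))"
    using adjpD[OF w, of x "w x"] adjpD[OF s, of x "s x"]
    by (simp add: ip_add_left ip_add_right ip_cscale_left ip_cscale_right ws cscale_cscale
        cscale_add_right cscale_diff_right cscale_minus_left)
  hence 1: "(norm (w x + cscale \<i> (s x)))\<^sup>2 = N"
    by (metis N_def norm_ip_self)
  have "ip (w x - cscale \<i> (s x)) (w x - cscale \<i> (s x)) = ip x (w (w x) + s (s x))"
    using adjpD[OF w, of x "w x"] adjpD[OF s, of x "s x"]
    by (simp add: ip_add_right ip_diff_left ip_diff_right ip_cscale_left ip_cscale_right ws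
        cscale_cscale cscale_add_right cscale_diff_right cscale_minus_left)
  hence 2: "(norm (w x - cscale \<i> (s x)))\<^sup>2 = N"
    by (metis N_def norm_ip_self)
  have "(w x + cscale \<i> (s x)) - (w x - cscale \<i> (s x)) = cscale (2 * \<i>) (s x)"
    using cscale_add_left[of \<i> \<i> "s x"] by simp
  hence "2 * norm (s x) = norm ((w x + cscale \<i> (s x)) - (w x - cscale \<i> (s x)))"
    by (simp add: norm_cscale norm_mult)
  also have "\<dots> \<le> norm (w x + cscale \<i> (s x)) + norm (w x - cscale \<i> (s x))"
    by (rule norm_triangle_ineq4)
  also have "\<dots> = 2 * sqrt N"
    by (simp flip: 1 add: 2[unfolded 1[symmetric], THEN power2_eq_imp_eq])
  finally have "norm (s x) \<le> sqrt N" by simp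
  thus ?thesis unfolding N_def by (simp add: real_le_rsqrt sqrt_ge_absD)
qed

end

section \<open>Square roots and positivity of operators\<close>

text \<open>The Cauchy--Schwarz inequality is not among the axioms of a Hilbert module. For the algebra
  as a module over itself it is immediate, and there it yields enough order theory to prove it
  for every Hilbert module. The theory of this section is used both times.\<close>

locale cauchy_schwarz_module = hilbert_module act ip
  for act :: "'h::complex_banach \<Rightarrow> 'a::cstar_algebra \<Rightarrow> 'h"
    and ip :: "'h \<Rightarrow> 'h \<Rightarrow> 'a" +
  assumes cauchy_schwarz: "norm (ip x y) \<le> norm x * norm y"
begin

sublocale ip: bounded_bilinear ip
proof
  show "\<exists>K. \<forall>a b. norm (ip a b) \<le> norm a * norm b * K"
    using cauchy_schwarz by (metis mult.right_neutral)
qed (simp_all add: ip_add_left ip_add_right ip_scaleR_left ip_scaleR_right)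

text \<open>Adjointable maps are bounded, by a Baire category argument in the style of the uniform
  boundedness principle: the sets \<open>{x. \<parallel>\<langle>x, S y\<rangle>\<parallel> \<le> k for all \<parallel>y\<parallel> \<le> 1}\<close> are closed and exhaust
  the module.\<close>

lemma adjp_bounded:
  assumes TS: "adjp T S"
  obtains K where "K > 0" "\<And>x. norm (T x) \<le> K * norm x"
proof -
  define F where "F k = {x. \<forall>y. norm y \<le> 1 \<longrightarrow> norm (ip x (S y)) \<le> real k}" for k :: nat
  have closed: "closed (F k)" for k
  proof -
    have "F k = (\<Inter>y\<in>{y. norm y \<le> 1}. {x. norm (ip x (S y)) \<le> real k})"
      unfolding F_def by auto
    moreover have "closed {x. norm (ip x (S y)) \<le> real k}" for y
      by (intro closed_Collect_le continuous_intros ip.continuous_on)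
    ultimately show ?thesis by auto
  qed
  have "x \<in> (\<Union>k. F k)" for x
  proof -
    obtain k where k: "norm (T x) \<le> real k" using real_arch_simple by blast
    have "norm (ip x (S y)) \<le> real k" if "norm y \<le> 1" for y
    proof -
      have "norm (ip x (S y)) \<le> norm (T x) * norm y"
        using cauchy_schwarz[of "T x" y] adjpD[OF TS, of x y] by simp
      also have "\<dots> \<le> norm (T x) * 1" using that by (intro mult_left_mono) auto
      finally show ?thesis using k by simp
    qed
    thus ?thesis unfolding F_def by auto
  qed
  hence un: "(\<Union>k. F k) = UNIV" by auto
  have "\<exists>k. interior (F k) \<noteq> {}"
  proof (rule ccontr)
    assume "\<not> ?thesis"
    hence "Met_TC.mtopology interior_of \<Union> (range F) = {}"
      by (intro Met_TC.metric_Baire_category_alt) (auto simp: complete_UNIV closed)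
    thus False using un by simp
  qed
  then obtain k x0 where "x0 \<in> interior (F k)" by blast
  then obtain e where e: "e > 0" "cball x0 e \<subseteq> F k"
    by (meson mem_interior_cball)
  have bnd: "norm (ip z (S y)) \<le> 2 * real k" if "norm z \<le> e" "norm y \<le> 1" for z y
  proof -
    have "x0 + z \<in> F k" "x0 \<in> F k" using e that by (auto simp: subset_iff dist_norm)
    hence "norm (ip (x0 + z) (S y)) \<le> k" "norm (ip x0 (S y)) \<le> k"
      using that unfolding F_def by auto
    moreover have "ip z (S y) = ip (x0 + z) (S y) - ip x0 (S y)" by (simp add: ip_add_left)
    ultimately show ?thesis using norm_triangle_ineq4[of "ip (x0 + z) (S y)" "ip x0 (S y)"] by simp
  qed
  have "norm (T x) \<le> (2 * k / e + 1) * norm x" for x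
  proof (cases "x = 0 \<or> T x = 0")
    case True
    thus ?thesis using adjp_map_zero[OF TS] e by auto
  next
    case False
    define z where "z = (e / norm x) *\<^sub>R x"
    define y where "y = (1 / norm (T x)) *\<^sub>R T x"
    have "norm (ip z (S y)) \<le> 2 * real k"
      using False e by (intro bnd) (auto simp: z_def y_def)
    moreover have "ip z (S y) = (e / norm x) *\<^sub>R (1 / norm (T x)) *\<^sub>R ip (T x) (T x)"
      unfolding adjpD[OF TS, symmetric] z_def y_def
      by (simp add: adjp_map_scaleR[OF TS] ip_scaleR_left ip_scaleR_right)
    ultimately have "e / norm x * (1 / norm (T x) * (norm (T x))\<^sup>2) \<le> 2 * k"
      using e False by (simp add: norm_ip_self)
    hence "norm (T x) \<le> 2 * k / e * norm x"
      using e False by (simp add: field_simps power2_eq_square)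
    also have "\<dots> \<le> (2 * k / e + 1) * norm x" by (intro mult_right_mono) auto
    finally show ?thesis .
  qed
  moreover have "2 * k / e + 1 > 0" using e by (simp add: add_nonneg_pos)
  ultimately show ?thesis using that by blast
qed

text \<open>The root \<open>1 - Y\<close> of \<open>1 - X\<close> comes from the iteration \<open>Y \<mapsto> (X + Y\<^sup>2) / 2\<close> started at \<open>0\<close>. With
  the number \<open>1\<close> in place of \<open>X\<close> the same iteration increases and stays below \<open>1\<close>, and its
  increments dominate those of the operators. Commutation with \<open>X\<close> passes to all iterates and
  to the limit.\<close>

lemma sqrt_of_one_minus_contraction:
  assumes X: "self_adjoint X" and contr: "\<And>x. norm (X x) \<le> norm x"
  obtains Y where "self_adjoint Y" "\<And>x. norm (Y x) \<le> norm x"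
    "\<And>x. 2 *\<^sub>R Y x - Y (Y x) = X x"
    "\<And>Z Z' x. adjp Z Z' \<Longrightarrow> (\<And>x. Z (X x) = X (Z x)) \<Longrightarrow> Z (Y x) = Y (Z x)"
proof -
  define Yn where "Yn n = rec_nat (\<lambda>x. 0) (\<lambda>_ Y x. (1/2) *\<^sub>R (X x + Y (Y x))) n" for n :: nat
  have Y0: "Yn 0 = (\<lambda>x. 0)" and YS: "Yn (Suc n) = (\<lambda>x. (1/2) *\<^sub>R (X x + Yn n (Yn n x)))" for n
    by (simp_all add: Yn_def)
  define yn where "yn n = rec_nat (0::real) (\<lambda>_ y. (1 + y * y) / 2) n" for n :: nat
  have y0: "yn 0 = 0" and yS: "yn (Suc n) = (1 + yn n * yn n) / 2" for n
    by (simp_all add: yn_def)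
  have y01: "0 \<le> yn n \<and> yn n \<le> 1" for n
  proof (induction n)
    case (Suc n)
    hence "yn n * yn n \<le> 1 * 1" by (intro mult_mono) auto
    thus ?case using Suc by (simp add: yS)
  qed (simp add: y0)
  have y_mono: "yn n \<le> yn (Suc n)" for n
  proof -
    have "0 \<le> (1 - yn n)\<^sup>2" by simp
    thus ?thesis by (simp add: yS power2_eq_square algebra_simps)
  qed
  have sa: "self_adjoint (Yn n)" for n
  proof (induction n)
    case 0 show ?case by (simp add: Y0 adjp_def)
  next
    case (Suc n)
    show ?case unfolding YS by (rule adjp_scaleR[OF adjp_add[OF X adjp_comp[OF Suc Suc]]])
  qed
  have bnd: "norm (Yn n x) \<le> yn n * norm x" for n x
  proof (induction n arbitrary: x)
    case (Suc n)
    have "norm (Yn n (Yn n x)) \<le> yn n * norm (Yn n x)" by (rule Suc)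
    also have "\<dots> \<le> yn n * (yn n * norm x)" using Suc y01 by (intro mult_left_mono) auto
    finally have "norm (X x + Yn n (Yn n x)) \<le> norm x + yn n * (yn n * norm x)"
      using contr[of x] norm_triangle_ineq[of "X x" "Yn n (Yn n x)"] by simp
    hence "norm (Yn (Suc n) x) \<le> (norm x + yn n * (yn n * norm x)) / 2" by (simp add: YS)
    also have "\<dots> = yn (Suc n) * norm x" by (simp add: yS algebra_simps)
    finally show ?case .
  qed (simp add: Y0 y0)
  have step: "norm (Yn (Suc n) x - Yn n x) \<le> (yn (Suc n) - yn n) * norm x" for n x
  proof (induction n arbitrary: x)
    case 0
    show ?case using contr[of x] by (simp add: Y0 YS y0 yS)
  next
    case (Suc n)
    let ?a = "Yn (Suc n)" and ?b = "Yn n"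
    have eq: "Yn (Suc (Suc n)) x - ?a x = (1/2) *\<^sub>R (?a (?a x - ?b x) + (?a (?b x) - ?b (?b x)))"
      by (subst (1 2) YS) (simp add: adjp_map_diff[OF sa] algebra_simps flip: scaleR_diff_right)
    have "norm (?a (?a x - ?b x)) \<le> yn (Suc n) * norm (?a x - ?b x)" by (rule bnd)
    also have "\<dots> \<le> yn (Suc n) * ((yn (Suc n) - yn n) * norm x)"
      using Suc y01 by (intro mult_left_mono) auto
    finally have 1: "norm (?a (?a x - ?b x)) \<le> yn (Suc n) * ((yn (Suc n) - yn n) * norm x)" .
    have "norm (?a (?b x) - ?b (?b x)) \<le> (yn (Suc n) - yn n) * norm (?b x)" by (rule Suc)
    also have "\<dots> \<le> (yn (Suc n) - yn n) * (yn n * norm x)"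
      using bnd y_mono by (intro mult_left_mono) auto
    finally have 2: "norm (?a (?b x) - ?b (?b x)) \<le> (yn (Suc n) - yn n) * (yn n * norm x)" .
    have "norm (Yn (Suc (Suc n)) x - ?a x) \<le>
        (1/2) * (yn (Suc n) * ((yn (Suc n) - yn n) * norm x) + (yn (Suc n) - yn n) * (yn n * norm x))"
      unfolding eq using norm_triangle_mono[OF 1 2] by simp
    also have "\<dots> = (yn (Suc (Suc n)) - yn (Suc n)) * norm x"
      by (subst (3 4) yS) (simp add: field_simps)
    finally show ?case .
  qed
  have diff: "norm (Yn (n + k) x - Yn n x) \<le> (yn (n + k) - yn n) * norm x" for n k x
  proof (induction k)
    case (Suc k)
    have "norm (Yn (n + Suc k) x - Yn n x)
        \<le> norm (Yn (Suc (n + k)) x - Yn (n + k) x) + norm (Yn (n + k) x - Yn n x)"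
      using norm_triangle_ineq[of "Yn (Suc (n + k)) x - Yn (n + k) x" "Yn (n + k) x - Yn n x"]
      by simp
    also have "\<dots> \<le> (yn (n + Suc k) - yn n) * norm x"
      using step[of "n + k" x] Suc by (simp add: algebra_simps)
    finally show ?case .
  qed simp
  have "incseq yn" using y_mono by (rule incseq_SucI)
  moreover have "bdd_above (range yn)" using y01 by (auto intro!: bdd_aboveI[of _ 1])
  ultimately have "convergent yn"
    by (metis Bseq_mono_convergent BseqI' y01 incseq_def norm_of_real abs_of_nonneg real_norm_def)
  hence yC: "Cauchy yn" by (simp add: Cauchy_convergent_iff)
  have "Cauchy (\<lambda>n. Yn n x)" for x
  proof (rule metric_CauchyI)
    fix e :: real assume e: "e > 0"
    define d where "d = e / (norm x + 1)"
    have n1: "norm x + 1 > 0" by (simp add: add_nonneg_pos)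
    have d: "d > 0" using e n1 by (simp add: d_def)
    then obtain M where M: "\<And>m n. m \<ge> M \<Longrightarrow> n \<ge> M \<Longrightarrow> dist (yn m) (yn n) < d"
      using metric_CauchyD[OF yC] by blast
    have lem: "dist (Yn m x) (Yn n x) < e" if "n \<ge> M" "m \<ge> n" for m n
    proof -
      have "dist (Yn m x) (Yn n x) \<le> (yn m - yn n) * norm x"
        using diff[of n "m - n" x] that by (simp add: dist_norm)
      also have "\<dots> \<le> d * norm x"
        using M[of m n] that by (intro mult_right_mono) (auto simp: dist_real_def)
      also have "\<dots> < d * (norm x + 1)" using d by (intro mult_strict_left_mono) auto
      finally show ?thesis using n1 by (simp add: d_def)
    qed
    show "\<exists>M. \<forall>m\<ge>M. \<forall>n\<ge>M. dist (Yn m x) (Yn n x) < e"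
      using lem by (metis dist_commute nle_le)
  qed
  hence "\<exists>l. (\<lambda>n. Yn n x) \<longlonglongrightarrow> l" for x
    by (simp add: Cauchy_convergent_iff convergent_def)
  then obtain Y where lim: "\<And>x. (\<lambda>n. Yn n x) \<longlonglongrightarrow> Y x" by metis
  have saY: "self_adjoint Y"
  proof (rule adjpI)
    fix x y
    have "(\<lambda>n. ip (Yn n x) y) \<longlonglongrightarrow> ip (Y x) y" by (intro ip.tendsto lim tendsto_const)
    moreover have "(\<lambda>n. ip (Yn n x) y) \<longlonglongrightarrow> ip x (Y y)"
      unfolding adjpD[OF sa] by (intro ip.tendsto lim tendsto_const)
    ultimately show "ip (Y x) y = ip x (Y y)" by (rule LIMSEQ_unique)
  qed
  have bnd1: "norm (Yn n x) \<le> norm x" for n x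
    using order_trans[OF bnd mult_right_mono[of "yn n" 1 "norm x"]] y01 by simp
  have bndY: "norm (Y x) \<le> norm x" for x
    by (rule Lim_bounded[OF tendsto_norm[OF lim]]) (simp add: bnd1)
  have sqlim: "(\<lambda>n. Yn n (Yn n x)) \<longlonglongrightarrow> Y (Y x)" for x
  proof -
    have "(\<lambda>n. Yn n (Yn n x - Y x)) \<longlonglongrightarrow> 0"
    proof (rule Lim_null_comparison)
      show "(\<lambda>n. norm (Yn n x - Y x)) \<longlonglongrightarrow> 0"
        using lim by (simp add: LIM_zero tendsto_norm_zero)
    qed (simp add: bnd1)
    from tendsto_add[OF this lim[of "Y x"]] show ?thesis
      by (simp add: adjp_map_diff[OF sa])
  qed
  have eqY: "2 *\<^sub>R Y x - Y (Y x) = X x" for x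
  proof -
    have "(\<lambda>n. Yn (Suc n) x) \<longlonglongrightarrow> (1/2) *\<^sub>R (X x + Y (Y x))"
      unfolding YS by (intro tendsto_intros sqlim)
    with lim[of x, THEN LIMSEQ_Suc] have "Y x = (1/2) *\<^sub>R (X x + Y (Y x))"
      by (rule LIMSEQ_unique)
    hence "2 *\<^sub>R Y x = X x + Y (Y x)" by (metis (no_types) scaleR_half_double scaleR_2 scaleR_add_right)
    thus ?thesis by simp
  qed
  have "Z (Y x) = Y (Z x)" if Z: "adjp Z Z'" and c: "\<And>x. Z (X x) = X (Z x)" for Z Z' x
  proof -
    have cn: "Z (Yn n x) = Yn n (Z x)" for n x
      by (induction n arbitrary: x) (simp_all add: Y0 YS adjp_linear[OF Z] c)
    show ?thesis
    proof (rule eq_if_ip_eq)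
      fix v
      have "(\<lambda>n. ip (Z' v) (Yn n x)) \<longlonglongrightarrow> ip (Z' v) (Y x)"
        by (intro ip.tendsto lim tendsto_const)
      moreover have "(\<lambda>n. ip (Z' v) (Yn n x)) \<longlonglongrightarrow> ip v (Y (Z x))"
        unfolding adjpD[OF adjp_sym[OF Z]] cn by (intro ip.tendsto lim tendsto_const)
      ultimately show "ip v (Z (Y x)) = ip v (Y (Z x))"
        unfolding adjpD[OF adjp_sym[OF Z], symmetric] by (rule LIMSEQ_unique)
    qed
  qed
  with saY bndY eqY show ?thesis using that by blast
qed

text \<open>A norm description of positivity, for which closure under sums is just the triangle
  inequality.\<close>

definition pos :: "('h \<Rightarrow> 'h) \<Rightarrow> bool" where
  "pos p \<longleftrightarrow> self_adjoint p \<and> (\<exists>r\<ge>0. \<forall>x. norm (r *\<^sub>R x - p x) \<le> r * norm x)"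

lemma pos_self_adjoint: "pos p \<Longrightarrow> self_adjoint p"
  by (simp add: pos_def)

lemma pos_add:
  assumes "pos p" "pos q" shows "pos (\<lambda>x. p x + q x)"
proof -
  obtain r s where r: "r \<ge> 0" "\<And>x. norm (r *\<^sub>R x - p x) \<le> r * norm x"
    and s: "s \<ge> 0" "\<And>x. norm (s *\<^sub>R x - q x) \<le> s * norm x"
    using assms unfolding pos_def by blast
  have "norm ((r + s) *\<^sub>R x - (p x + q x)) \<le> (r + s) * norm x" for x
    using norm_triangle_mono[OF r(2)[of x] s(2)[of x]] by (simp add: algebra_simps)
  moreover have "r + s \<ge> 0" using r s by simp
  ultimately show ?thesis
    unfolding pos_def using adjp_add[OF assms[THEN pos_self_adjoint]] by blast
qed

lemma pos_scaleR:
  assumes "pos p" "c \<ge> 0" shows "pos (\<lambda>x. c *\<^sub>R p x)"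
proof -
  obtain r where r: "r \<ge> 0" "\<And>x. norm (r *\<^sub>R x - p x) \<le> r * norm x"
    using assms unfolding pos_def by blast
  have "norm ((c * r) *\<^sub>R x - c *\<^sub>R p x) \<le> (c * r) * norm x" for x
  proof -
    have "norm ((c * r) *\<^sub>R x - c *\<^sub>R p x) = c * norm (r *\<^sub>R x - p x)"
      using assms(2) by (metis norm_scaleR abs_of_nonneg scaleR_diff_right scaleR_scaleR)
    thus ?thesis using mult_left_mono[OF r(2) assms(2)] by (simp add: mult.assoc)
  qed
  moreover have "c * r \<ge> 0" using r assms by simp
  ultimately show ?thesis
    unfolding pos_def using adjp_scaleR[OF pos_self_adjoint[OF assms(1)]] by blast
qed

lemma posE:
  assumes "pos p"
  obtains r where "r > 0" "\<And>x. norm (r *\<^sub>R x - p x) \<le> r * norm x"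
proof -
  obtain r where r: "r \<ge> 0" "\<And>x. norm (r *\<^sub>R x - p x) \<le> r * norm x"
    using assms unfolding pos_def by blast
  have "norm ((r + 1) *\<^sub>R x - p x) \<le> (r + 1) * norm x" for x
    using norm_triangle_ineq[of "r *\<^sub>R x - p x" x] r(2)[of x] by (simp add: algebra_simps)
  thus ?thesis using r that[of "r + 1"] by simp
qed

lemma pos_has_sqrt:
  assumes p: "pos p"
  obtains s where "pos s" "\<And>x. s (s x) = p x"
    "\<And>Z Z' x. adjp Z Z' \<Longrightarrow> (\<And>x. Z (p x) = p (Z x)) \<Longrightarrow> Z (s x) = s (Z x)"
proof -
  obtain r where r: "r > 0" "\<And>x. norm (r *\<^sub>R x - p x) \<le> r * norm x"
    using posE[OF p] by blast
  define X where "X x = x - (1/r) *\<^sub>R p x" for x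
  have saX: "self_adjoint X"
    unfolding X_def by (rule adjp_diff[OF adjp_id adjp_scaleR[OF pos_self_adjoint[OF p]]])
  have "norm (X x) \<le> norm x" for x
  proof -
    have "X x = (1/r) *\<^sub>R (r *\<^sub>R x - p x)" using r by (simp add: X_def scaleR_diff_right)
    hence "norm (X x) = norm (r *\<^sub>R x - p x) / r" using r by simp
    also have "\<dots> \<le> (r * norm x) / r" using r by (intro divide_right_mono) auto
    finally show ?thesis using r by simp
  qed
  then obtain Y where Y: "self_adjoint Y" "\<And>x. norm (Y x) \<le> norm x"
    "\<And>x. 2 *\<^sub>R Y x - Y (Y x) = X x"
    "\<And>Z Z' x. adjp Z Z' \<Longrightarrow> (\<And>x. Z (X x) = X (Z x)) \<Longrightarrow> Z (Y x) = Y (Z x)"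
    using sqrt_of_one_minus_contraction[OF saX] by metis
  define s where "s x = sqrt r *\<^sub>R (x - Y x)" for x
  have sas: "self_adjoint s"
    unfolding s_def by (rule adjp_scaleR[OF adjp_diff[OF adjp_id Y(1)]])
  have "norm (sqrt r *\<^sub>R x - s x) \<le> sqrt r * norm x" for x
    using Y(2)[of x] r by (simp add: s_def algebra_simps)
  hence "pos s" unfolding pos_def using sas r by (intro conjI exI[of _ "sqrt r"]) auto
  moreover have "s (s x) = p x" for x
  proof -
    have "s (s x) = r *\<^sub>R (x - (2 *\<^sub>R Y x - Y (Y x)))"
      using r by (simp add: s_def adjp_linear[OF Y(1)] scaleR_2 algebra_simps)
    thus ?thesis using r by (simp add: Y(3) X_def)
  qed
  moreover have "Z (s x) = s (Z x)" if Z: "adjp Z Z'" and c: "\<And>x. Z (p x) = p (Z x)" for Z Z' x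
    using Y(4)[OF Z] by (simp add: s_def X_def adjp_linear[OF Z] c)
  ultimately show ?thesis using that by blast
qed

text \<open>A root that commutes with the whole commutant of \<open>p\<close>. For positive \<open>p\<close> the lemma
  \<open>pos_sqrt_unique\<close> below identifies it as the only positive root.\<close>

definition op_sqrt :: "('h \<Rightarrow> 'h) \<Rightarrow> ('h \<Rightarrow> 'h)" where
  "op_sqrt p = (SOME s. pos s \<and> (\<forall>x. s (s x) = p x) \<and>
     (\<forall>Z Z'. adjp Z Z' \<longrightarrow> (\<forall>x. Z (p x) = p (Z x)) \<longrightarrow> (\<forall>x. Z (s x) = s (Z x))))"

lemma op_sqrt:
  assumes "pos p"
  shows "pos (op_sqrt p)" "op_sqrt p (op_sqrt p x) = p x"
    "adjp Z Z' \<Longrightarrow> (\<And>x. Z (p x) = p (Z x)) \<Longrightarrow> Z (op_sqrt p x) = op_sqrt p (Z x)"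
proof -
  have "\<exists>s. pos s \<and> (\<forall>x. s (s x) = p x) \<and>
     (\<forall>Z Z'. adjp Z Z' \<longrightarrow> (\<forall>x. Z (p x) = p (Z x)) \<longrightarrow> (\<forall>x. Z (s x) = s (Z x)))"
    by (rule pos_has_sqrt[OF assms]) blast
  from someI_ex[OF this, folded op_sqrt_def]
  show "pos (op_sqrt p)" "op_sqrt p (op_sqrt p x) = p x"
    "adjp Z Z' \<Longrightarrow> (\<And>x. Z (p x) = p (Z x)) \<Longrightarrow> Z (op_sqrt p x) = op_sqrt p (Z x)"
    by blast+
qed

lemma pos_square:
  assumes s: "self_adjoint s" shows "pos (\<lambda>x. s (s x))"
proof -
  obtain K where K: "K > 0" "\<And>x. norm (s x) \<le> K * norm x" using adjp_bounded[OF s] by blast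
  define t where "t x = (1/K) *\<^sub>R s x" for x
  have t: "self_adjoint t" unfolding t_def by (rule adjp_scaleR[OF s])
  have tc: "norm (t x) \<le> norm x" for x using K by (simp add: t_def field_simps)
  have "norm (t (t x)) \<le> norm x" for x using tc order_trans by blast
  then obtain Y where Y: "self_adjoint Y" "\<And>x. 2 *\<^sub>R Y x - Y (Y x) = t (t x)"
    "\<And>Z Z' x. adjp Z Z' \<Longrightarrow> (\<And>x. Z (t (t x)) = t (t (Z x))) \<Longrightarrow> Z (Y x) = Y (Z x)"
    using sqrt_of_one_minus_contraction[OF adjp_comp[OF t t]] by metis
  \<comment> \<open>\<open>t\<^sup>2 + d\<^sup>2 = 1\<close>, so \<open>d\<close> is a contraction and hence so is \<open>d\<^sup>2 = 1 - t\<^sup>2\<close>\<close>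
  define d where "d x = x - Y x" for x
  have d: "self_adjoint d" unfolding d_def by (rule adjp_diff[OF adjp_id Y(1)])
  have comm: "t (d x) = d (t x)" for x
    using Y(3)[OF t, of x] by (simp add: d_def adjp_linear[OF t])
  have dd: "d (d x) = x - t (t x)" for x
    using Y(2)[of x, symmetric] by (simp add: d_def adjp_linear[OF Y(1)] scaleR_2)
  have dc: "norm (d x) \<le> norm x" for x
  proof -
    have "(norm (d x))\<^sup>2 \<le> norm (ip x x)"
      using norm_le_sum_of_squares[OF t d comm, of x] by (simp add: dd)
    thus ?thesis by (simp add: norm_ip_self)
  qed
  have "norm (K\<^sup>2 *\<^sub>R x - s (s x)) \<le> K\<^sup>2 * norm x" for x
  proof -
    have "s y = K *\<^sub>R t y" for y using K by (simp add: t_def)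
    hence "K\<^sup>2 *\<^sub>R x - s (s x) = K\<^sup>2 *\<^sub>R d (d x)"
      by (simp add: dd adjp_linear[OF t] power2_eq_square scaleR_diff_right)
    thus ?thesis using order_trans[OF dc dc, of x] by (simp add: mult_left_mono)
  qed
  thus ?thesis unfolding pos_def using adjp_comp[OF s s] by (intro conjI exI[of _ "K\<^sup>2"]) auto
qed

text \<open>The square roots of \<open>p\<close> and \<open>- p\<close> commute and their squares add up to \<open>0\<close>.\<close>

lemma pos_proper:
  assumes p: "pos p" and q: "pos (\<lambda>x. - p x)"
  shows "p x = 0"
proof -
  define w where "w = op_sqrt p"
  note w = op_sqrt[OF p, folded w_def]
  define s where "s = op_sqrt (\<lambda>x. - p x)"
  note s = op_sqrt[OF q, folded s_def]
  have W: "self_adjoint w" and S: "self_adjoint s" using w s by (auto dest: pos_self_adjoint)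
  have "w (p y) = p (w y)" for y by (simp flip: w(2))
  hence "w (- p y) = - p (w y)" for y
    using adjp_map_scaleR[OF W, of "-1"] by simp
  hence comm: "s (w y) = w (s y)" for y using s(3)[OF W] by metis
  have "(norm (w y))\<^sup>2 \<le> norm (ip y (s (s y) + w (w y)))" for y
    by (rule norm_le_sum_of_squares[OF S W comm])
  hence "w y = 0" for y by (simp add: w s)
  thus ?thesis using w(2)[of x] by simp
qed

lemma zero_if_square_zero: "self_adjoint n \<Longrightarrow> n (n x) = 0 \<Longrightarrow> n x = 0"
  by (rule zero_if_adj_comp_zero)

text \<open>For self-adjoint \<open>g\<close> the norms \<open>\<parallel>g\<^sup>n x\<parallel>\<close> are logarithmically convex in \<open>n\<close>, so they grow
  geometrically unless \<open>g\<close> is a contraction.\<close>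

lemma contraction_if_linear_growth:
  assumes g: "self_adjoint g" and growth: "\<And>n x. norm ((g ^^ n) x) \<le> (1 + real n * K) * norm x"
  shows "norm (g x) \<le> norm x"
proof (rule ccontr)
  assume "\<not> ?thesis"
  hence gt: "norm (g x) > norm x" by simp
  hence gx: "g x \<noteq> 0" by auto
  hence x: "norm x > 0" using adjp_map_zero[OF g] by auto
  define q where "q = norm (g x) / norm x"
  have q: "q > 1" using gt x by (simp add: q_def)
  have conv: "(norm (g y))\<^sup>2 \<le> norm y * norm (g (g y))" for y
    using cauchy_schwarz[of y "g (g y)"] adjpD[OF g, of y "g y"] by (metis norm_ip_self)
  have ratio: "norm ((g ^^ Suc n) x) \<ge> q * norm ((g ^^ n) x) \<and> norm ((g ^^ n) x) > 0" for n
  proof (induction n)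
    case 0 show ?case using x by (simp add: q_def)
  next
    case (Suc n)
    let ?a = "norm ((g ^^ n) x)" and ?b = "norm ((g ^^ Suc n) x)" and ?c = "norm ((g ^^ Suc (Suc n)) x)"
    have a: "?a > 0" and ab: "q * ?a \<le> ?b" using Suc by auto
    hence b: "?b > 0" using q by (meson less_le_trans mult_pos_pos order_less_trans zero_less_one)
    have "?a * (q * ?b) = (q * ?a) * ?b" by simp
    also have "\<dots> \<le> ?b * ?b" using ab by (intro mult_right_mono) auto
    also have "\<dots> \<le> ?a * ?c" using conv[of "(g ^^ n) x"] by (simp add: power2_eq_square)
    finally have "q * ?b \<le> ?c" using a by simp
    thus ?case using b by simp
  qed
  have pw: "norm ((g ^^ n) x) \<ge> q ^ n * norm x" for n
  proof (induction n)
    case (Suc n)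
    have "q ^ Suc n * norm x \<le> q * norm ((g ^^ n) x)" using Suc q by (simp add: mult.assoc)
    thus ?case using ratio[of n] by simp
  qed simp
  have bound: "q ^ n \<le> 1 + real n * K" for n
    using order_trans[OF pw growth, of n] x by simp
  have lin: "(\<lambda>n. (1 + real n * K) / q ^ n) \<longlonglongrightarrow> 0"
  proof -
    have "norm (1/q) < 1" using q by simp
    from tendsto_mult_right[OF powser_times_n_limit_0[OF this], of K]
    have "(\<lambda>n. real n * (1/q) ^ n * K) \<longlonglongrightarrow> 0" by simp
    moreover have "(\<lambda>n. (1/q) ^ n) \<longlonglongrightarrow> 0" using q by (intro LIMSEQ_realpow_zero) auto
    ultimately have "(\<lambda>n. (1/q) ^ n + real n * (1/q) ^ n * K) \<longlonglongrightarrow> 0"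
      using tendsto_add by fastforce
    thus ?thesis by (simp add: power_one_over add_divide_distrib field_simps)
  qed
  have "(1 + real n * K) / q ^ n \<ge> 1" for n using bound[of n] q by (simp add: field_simps)
  hence "1 \<le> (0::real)" using lin by (intro LIMSEQ_le_const[OF lin]) auto
  thus False by simp
qed

text \<open>Scale so that \<open>B = 1 + c\<^sup>* c / r\<close> is a contraction and put \<open>g = 1 + c c\<^sup>* / r\<close>. From
  \<open>c\<^sup>* g = B c\<^sup>*\<close> it follows that \<open>g\<^bsup>n+1\<^esup> - g\<^sup>n = c B\<^sup>n c\<^sup>* / r\<close> is bounded in \<open>n\<close>. So the powers of
  \<open>g\<close> grow at most linearly, \<open>g\<close> is a contraction, and this says that \<open>- c c\<^sup>*\<close> is positive. On the
  other hand \<open>2 c c\<^sup>* = h\<^sup>2 + k\<^sup>2 + 2 w\<^sup>2\<close> with the self-adjoint \<open>h = c + c\<^sup>*\<close> and \<open>k = i (c - c\<^sup>*)\<close>,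
  so \<open>c c\<^sup>*\<close> is positive as well.\<close>

lemma zero_if_adj_comp_negative:
  assumes c: "adjp c c'" and w: "self_adjoint w" and eq: "\<And>x. c' (c x) = - w (w x)"
  shows "c x = 0"
proof -
  have c': "adjp c' c" by (rule adjp_sym[OF c])
  obtain r where r: "r > 0" "\<And>x. norm (r *\<^sub>R x - w (w x)) \<le> r * norm x"
    using posE[OF pos_square[OF w]] by blast
  define B where "B x = x + (1/r) *\<^sub>R c' (c x)" for x
  define g where "g x = x + (1/r) *\<^sub>R c (c' x)" for x
  have B: "norm (B x) \<le> norm x" for x
  proof -
    have "B x = (1/r) *\<^sub>R (r *\<^sub>R x - w (w x))"
      using r by (simp add: B_def eq scaleR_diff_right)
    hence "norm (B x) = norm (r *\<^sub>R x - w (w x)) / r" using r by simp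
    also have "\<dots> \<le> (r * norm x) / r" using r by (intro divide_right_mono) auto
    finally show ?thesis using r by simp
  qed
  have g: "self_adjoint g"
    unfolding g_def by (rule adjp_add[OF adjp_id adjp_scaleR[OF adjp_comp[OF c c']]])
  obtain K1 K2 where K1: "K1 > 0" "\<And>x. norm (c x) \<le> K1 * norm x"
    and K2: "K2 > 0" "\<And>x. norm (c' x) \<le> K2 * norm x"
    using adjp_bounded[OF c] adjp_bounded[OF c'] by metis
  define K where "K = K1 * K2 / r"
  have intertwine: "c' ((g ^^ n) x) = (B ^^ n) (c' x)" for n x
    by (induction n) (simp_all add: g_def B_def adjp_linear[OF c'])
  have Bn: "norm ((B ^^ n) x) \<le> norm x" for n x
  proof (induction n)
    case (Suc n) thus ?case using B[of "(B ^^ n) x"] by simp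
  qed simp
  have "norm ((g ^^ n) x) \<le> (1 + real n * K) * norm x" for n x
  proof (induction n)
    case (Suc n)
    have "norm (c (c' ((g ^^ n) x))) \<le> K1 * norm ((B ^^ n) (c' x))"
      unfolding intertwine by (rule K1)
    also have "\<dots> \<le> K1 * (K2 * norm x)"
      using K1(1) order_trans[OF Bn K2(2)] by (intro mult_left_mono) auto
    finally have "(1/r) * norm (c (c' ((g ^^ n) x))) \<le> (1/r) * (K1 * (K2 * norm x))"
      using r by (intro mult_left_mono) auto
    hence "norm ((1/r) *\<^sub>R c (c' ((g ^^ n) x))) \<le> K * norm x" using r by (simp add: K_def)
    hence "norm ((g ^^ Suc n) x) \<le> (1 + real n * K) * norm x + K * norm x"
      using norm_triangle_mono[OF Suc] by (simp add: g_def[of "(g ^^ n) x"])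
    thus ?case by (simp add: algebra_simps)
  qed simp
  hence gc: "norm (g x) \<le> norm x" for x by (rule contraction_if_linear_growth[OF g])
  have neg: "pos (\<lambda>x. - c (c' x))"
  proof -
    have "norm (r *\<^sub>R x - - c (c' x)) \<le> r * norm x" for x
    proof -
      have "r *\<^sub>R x - - c (c' x) = r *\<^sub>R g x" using r by (simp add: g_def scaleR_add_right)
      thus ?thesis using gc[of x] r by simp
    qed
    thus ?thesis unfolding pos_def
      using r adjp_scaleR[OF adjp_comp[OF c c'], of "-1"] by (intro conjI exI[of _ r]) auto
  qed
  define h where "h x = c x + c' x" for x
  define k where "k x = cscale \<i> (c x - c' x)" for x
  have h: "self_adjoint h"
    using adjp_add[OF c c'] unfolding h_def by (simp add: add.commute)
  have k: "self_adjoint k"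
    using adjp_cscale[OF adjp_diff[OF c c'], of \<i>] unfolding k_def
    by (simp add: cscale_minus_left cscale_diff_right)
  have "(1/2) *\<^sub>R ((h (h x) + k (k x)) + (w (w x) + w (w x))) = c (c' x)" for x
  proof -
    have "w (w x) = - c' (c x)" by (simp add: eq)
    moreover have "h (h x) + k (k x) = 2 *\<^sub>R (c (c' x) + c' (c x))"
      by (simp add: h_def k_def adjp_linear[OF c] adjp_linear[OF c'] cscale_diff_right
          cscale_cscale cscale_minus_left scaleR_2)
    ultimately show ?thesis by (simp add: scaleR_2)
  qed
  moreover have "pos (\<lambda>x. (1/2) *\<^sub>R ((h (h x) + k (k x)) + (w (w x) + w (w x))))"
    by (intro pos_scaleR pos_add pos_square h k w) simp
  ultimately have "pos (\<lambda>x. c (c' x))" by simp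
  from pos_proper[OF this neg] have "c' x = 0" for x
    by (rule zero_if_adj_comp_zero[OF c'])
  thus ?thesis using zero_if_adj_comp_zero[OF c] by simp
qed

text \<open>The square \<open>p\<^sup>2\<close> has a positive root \<open>m\<close>, the candidate for \<open>|p|\<close>. The operator
  \<open>n = m - p\<close> satisfies \<open>p n = - m n\<close>, so for \<open>c = t n\<close> the
  product \<open>c\<^sup>* c = n p n = - m n\<^sup>2\<close> is the negative of the square of \<open>m\<^bsup>1/2\<^esup> n\<close>. Hence \<open>c\<close> vanishes, and with it \<open>n\<close>.\<close>

theorem pos_adj_comp:
  assumes t: "adjp t t'" shows "pos (\<lambda>x. t' (t x))"
proof -
  define p where "p x = t' (t x)" for x
  have p: "self_adjoint p" unfolding p_def by (rule adjp_comp[OF adjp_sym[OF t] t])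
  define m where "m = op_sqrt (\<lambda>x. p (p x))"
  note m = op_sqrt[OF pos_square[OF p], folded m_def]
  define r where "r = op_sqrt m"
  note r = op_sqrt[OF m(1), folded r_def]
  have M: "self_adjoint m" and R: "self_adjoint r" using m r by (auto dest: pos_self_adjoint)
  have pm: "p (m x) = m (p x)" for x by (rule m(3)[OF p]) simp
  have pr: "p (r x) = r (p x)" for x by (rule r(3)[OF p pm])
  have mr: "m (r x) = r (m x)" for x by (simp flip: r(2))
  \<comment> \<open>\<open>n\<close> is twice the negative part of \<open>p\<close>\<close>
  define n where "n x = m x - p x" for x
  have n: "self_adjoint n" unfolding n_def by (rule adjp_diff[OF M p])
  have rn: "r (n x) = n (r x)" for x by (simp add: n_def adjp_linear[OF R] pr mr)
  have mn: "m (n x) = n (m x)" for x by (simp add: n_def adjp_linear[OF M] pm)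
  have pn: "p (n x) = - m (n x)" for x
    by (simp add: n_def adjp_linear[OF M] adjp_linear[OF p] m(2) pm)
  have nn: "n (n x) = 2 *\<^sub>R m (n x)" for x
    using pn[of x] by (simp add: n_def[of "n x"] scaleR_2)
  define c where "c x = t (n x)" for x
  define c' where "c' x = n (t' x)" for x
  have c: "adjp c c'" unfolding c_def c'_def by (rule adjp_comp[OF t n])
  define w where "w x = r (n x)" for x
  have w: "self_adjoint w" using adjp_comp[OF R n] unfolding w_def by (simp add: rn)
  have "c' (c x) = - w (w x)" for x
  proof -
    have "c' (c x) = n (p (n x))" by (simp add: c_def c'_def p_def)
    also have "\<dots> = - n (m (n x))" using adjp_map_scaleR[OF n, of "-1"] by (simp add: pn)
    also have "\<dots> = - w (w x)" by (simp add: w_def rn flip: r(2))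
    finally show ?thesis .
  qed
  from zero_if_adj_comp_negative[OF c w this] have "c x = 0" for x .
  hence "n (p (n x)) = 0" for x
    using adjp_map_zero[OF n] adjp_map_zero[OF adjp_sym[OF t]] by (simp add: c_def p_def)
  hence nmn: "n (m (n x)) = 0" for x
    using adjp_map_scaleR[OF n, of "-1"] by (simp add: pn)
  have "n (n (n x)) = 0" for x by (simp add: nn adjp_linear[OF n] nmn)
  hence "n (n x) = 0" for x using zero_if_square_zero[OF n, of "n x"] by simp
  hence "n x = 0" for x using zero_if_square_zero[OF n] by blast
  hence "m = p" by (auto simp: n_def)
  thus ?thesis using m(1) unfolding p_def by simp
qed

lemma pos_conj: "pos p \<Longrightarrow> adjp t t' \<Longrightarrow> pos (\<lambda>x. t' (p (t x)))"
proof -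
  assume p: "pos p" and t: "adjp t t'"
  define s where "s = op_sqrt p"
  note s = op_sqrt[OF p, folded s_def]
  show ?thesis
    using pos_adj_comp[OF adjp_comp[OF pos_self_adjoint[OF s(1)] t]] by (simp add: s(2))
qed

text \<open>Both \<open>r - (p + q)\<close> and \<open>q\<close> are positive, so \<open>r - p\<close> is. The roots of \<open>p\<close> and \<open>r - p\<close>
  commute and their squares add up to \<open>r\<close>.\<close>

lemma pos_summand_bound:
  assumes p: "pos p" and q: "pos q" and r: "r \<ge> 0"
    and bound: "\<And>x. norm (p x + q x) \<le> r * norm x"
  shows "norm (p x) \<le> r * norm x"
proof -
  have sa: "self_adjoint p" "self_adjoint q" using p q by (auto dest: pos_self_adjoint)
  have "pos (\<lambda>x. r *\<^sub>R x - (p x + q x))"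
    unfolding pos_def using r bound adjp_diff[OF adjp_scaleR[OF adjp_id] adjp_add[OF sa]]
    by (intro conjI exI[of _ r]) (auto simp: add.commute)
  from pos_add[OF this q] have rp: "pos (\<lambda>x. r *\<^sub>R x - p x)" by (simp add: diff_diff_eq2 add.commute)
  define w where "w = op_sqrt p"
  note w = op_sqrt[OF p, folded w_def]
  define s where "s = op_sqrt (\<lambda>x. r *\<^sub>R x - p x)"
  note s = op_sqrt[OF rp, folded s_def]
  have W: "self_adjoint w" and S: "self_adjoint s" using w s by (auto dest: pos_self_adjoint)
  have "w (r *\<^sub>R y - p y) = r *\<^sub>R w y - p (w y)" for y
    by (simp add: adjp_linear[OF W] flip: w(2))
  hence comm: "s (w y) = w (s y)" for y using s(3)[OF W] by metis
  have wb: "norm (w y) \<le> sqrt r * norm y" for y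
  proof -
    have "(norm (w y))\<^sup>2 \<le> norm (ip y (r *\<^sub>R y))"
      using norm_le_sum_of_squares[OF S W comm, of y] by (simp add: w s)
    also have "\<dots> = (sqrt r * norm y)\<^sup>2"
      using r by (simp add: ip_scaleR_right norm_ip_self power_mult_distrib)
    finally show ?thesis using r by (simp add: power2_le_iff_abs_le)
  qed
  have "norm (p x) \<le> sqrt r * (sqrt r * norm x)"
    using order_trans[OF wb mult_left_mono[OF wb]] r by (simp flip: w(2))
  thus ?thesis using r by (simp flip: mult.assoc)
qed

text \<open>It suffices to compare a positive root \<open>A'\<close> of \<open>P\<close> with the root \<open>S\<close> that commutes with it.
  For \<open>D = A' - S\<close> the positive operators \<open>D A' D\<close> and \<open>D S D\<close> add up to \<open>D (A'\<^sup>2 - S\<^sup>2) = 0\<close>, so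
  both vanish, and so does their difference \<open>D\<^sup>3\<close>.\<close>

lemma pos_sqrt_unique:
  assumes A: "pos A" and C: "pos C" and eq: "\<And>x. A (A x) = C (C x)"
  shows "A = C"
proof -
  define P where "P x = A (A x)" for x
  have P: "pos P" unfolding P_def by (rule pos_square[OF pos_self_adjoint[OF A]])
  define S where "S = op_sqrt P"
  note S = op_sqrt[OF P, folded S_def]
  have "A' = S" if A': "pos A'" and sq: "\<And>x. A' (A' x) = P x" for A'
  proof -
    have sa: "self_adjoint A'" "self_adjoint S" using A' S by (auto dest: pos_self_adjoint)
    have comm: "A' (S x) = S (A' x)" for x by (rule S(3)[OF sa(1)]) (simp flip: sq)
    define D where "D x = A' x - S x" for x
    have D: "self_adjoint D" unfolding D_def by (rule adjp_diff[OF sa])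
    have sum0: "D (A' (D x)) = - D (S (D x))" for x
    proof -
      have "A' (D x) + S (D x) = 0"
        by (simp add: D_def adjp_linear[OF sa(1)] adjp_linear[OF sa(2)] comm sq S(2))
      thus ?thesis by (metis adjp_map_add[OF D] adjp_map_zero[OF D] eq_neg_iff_add_eq_0)
    qed
    have "D (S (D x)) = 0" for x
      by (rule pos_proper[OF pos_conj[OF S(1) D]]) (use pos_conj[OF A' D] sum0 in simp)
    moreover from this have "D (A' (D x)) = 0" for x by (simp add: sum0)
    ultimately have "D (D (D x)) = 0" for x
      by (simp add: D_def[of "D x" for x] adjp_linear[OF D])
    hence "D (D x) = 0" for x using zero_if_square_zero[OF D, of "D x"] by simp
    hence "D x = 0" for x using zero_if_square_zero[OF D] by blast
    thus ?thesis by (auto simp: D_def)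
  qed
  from this[OF A] this[OF C] show ?thesis by (simp add: P_def eq)
qed

end

section \<open>Cauchy--Schwarz for every Hilbert module\<close>

text \<open>Here Cauchy--Schwarz is just \<open>\<parallel>x\<^sup>* y\<parallel> \<le> \<parallel>x\<^sup>*\<parallel> \<parallel>y\<parallel>\<close>.\<close>

lemma algebra_over_itself: "cauchy_schwarz_module (*) (\<lambda>x y::'a::cstar_algebra. star x * y)"
proof
  show "cstar_positive (star x * x)" for x :: 'a unfolding cstar_positive_def by blast
  show "star x * x = 0 \<Longrightarrow> x = 0" for x :: 'a
    using cstar_identity[of x] by simp
  show "norm (star x * y) \<le> norm x * norm y" for x y :: 'a
    using norm_mult_ineq[of "star x" y] by simp
qed (simp_all add: cscale_mult_left cscale_mult_right star_add star_cscale star_mult star_star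
    cstar_identity algebra_simps)

text \<open>An algebra without unit acts on itself by left multiplication, and there the bound for
  positive operators applies.\<close>

lemma norm_le_norm_add_positive:
  fixes a b :: "'a::cstar_algebra"
  shows "norm (star a * a) \<le> norm (star a * a + star b * b)"
proof -
  interpret A: cauchy_schwarz_module "(*)" "\<lambda>x y::'a. star x * y" by (rule algebra_over_itself)
  have mult: "A.adjp ((*) c) ((*) (star c))" for c
    by (simp add: A.adjp_def star_mult mult.assoc)
  let ?p = "star a * a" and ?r = "norm (star a * a + star b * b)"
  have "norm (star a * (a * star ?p)) \<le> ?r * norm (star ?p)"
  proof (rule A.pos_summand_bound[OF A.pos_adj_comp[OF mult] A.pos_adj_comp[OF mult]])
    show "norm (star a * (a * x) + star b * (b * x)) \<le> ?r * norm x" for x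
      using norm_mult_ineq[of "star a * a + star b * b" x] by (simp add: algebra_simps)
  qed simp
  moreover have "norm (?p * star ?p) = (norm ?p)\<^sup>2"
    using cstar_identity[of "star ?p"] by (simp add: star_star star_mult)
  ultimately have "norm ?p * norm ?p \<le> ?r * norm ?p"
    by (simp add: mult.assoc power2_eq_square star_mult star_star)
  thus ?thesis by (cases "norm ?p = 0") auto
qed

text \<open>Expand \<open>\<langle>z, z\<rangle>\<close> for \<open>z = x a - t y\<close> with \<open>a = \<langle>x, y\<rangle>\<close> and \<open>t = \<parallel>x\<parallel>\<^sup>2\<close>: the positive element
  \<open>2 t a\<^sup>* a\<close> is a summand of \<open>a\<^sup>* \<langle>x, x\<rangle> a + t\<^sup>2 \<langle>y, y\<rangle>\<close>, hence bounded by it in norm.\<close>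

lemma (in hilbert_module) cauchy_schwarz_ineq: "norm (ip x y) \<le> norm x * norm y"
proof (cases "x = 0")
  case False
  define a where "a = ip x y"
  define t where "t = (norm x)\<^sup>2"
  have t: "t > 0" using False by (simp add: t_def)
  obtain b where b: "ip x x = star b * b" using ip_positive[of x] by (auto simp: cstar_positive_def)
  obtain e where e: "ip y y = star e * e" using ip_positive[of y] by (auto simp: cstar_positive_def)
  define z where "z = act x a - t *\<^sub>R y"
  obtain d where d: "ip z z = star d * d" using ip_positive[of z] by (auto simp: cstar_positive_def)
  have "ip y x = star a" by (metis a_def ip_star)
  moreover have "(2 * t) *\<^sub>R u = t *\<^sub>R u + t *\<^sub>R u" for u :: 'a
    by (metis mult_2 scaleR_add_left)
  ultimately have zz: "ip z z = star (b * a) * (b * a) - (2 * t) *\<^sub>R (star a * a) + (t * t) *\<^sub>R ip y y"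
    by (simp add: z_def ip_diff_left ip_diff_right ip_act_left ip_act_right ip_scaleR_left
        ip_scaleR_right b star_mult algebra_simps flip: a_def)
  define f where "f = sqrt (2 * t) *\<^sub>R a"
  have f: "star f * f = (2 * t) *\<^sub>R (star a * a)" using t by (simp add: f_def star_scaleR)
  have "2 * t * (norm a)\<^sup>2 = norm (star f * f)"
    unfolding f using t by (simp add: cstar_identity)
  also have "\<dots> \<le> norm (star f * f + star d * d)" by (rule norm_le_norm_add_positive)
  also have "star f * f + star d * d = star a * ip x x * a + (t * t) *\<^sub>R ip y y"
    by (simp add: f d[symmetric] zz b star_mult mult.assoc)
  also have "norm \<dots> \<le> norm a * t * norm a + (t * t) * (norm y)\<^sup>2"
  proof (rule norm_triangle_mono)
    have "norm (star a * ip x x * a) \<le> norm (star a * ip x x) * norm a" by (rule norm_mult_ineq)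
    also have "\<dots> \<le> (norm (star a) * norm (ip x x)) * norm a"
      by (intro mult_right_mono norm_mult_ineq) auto
    finally show "norm (star a * ip x x * a) \<le> norm a * t * norm a"
      by (simp add: norm_ip_self t_def)
  qed (simp add: norm_ip_self)
  finally have "t * (norm a)\<^sup>2 \<le> t * (t * (norm y)\<^sup>2)"
    by (simp add: power2_eq_square algebra_simps)
  hence "(norm a)\<^sup>2 \<le> t * (norm y)\<^sup>2" using t by simp
  hence "(norm a)\<^sup>2 \<le> (norm x * norm y)\<^sup>2" by (simp add: t_def power_mult_distrib)
  thus ?thesis unfolding a_def by (rule power2_le_imp_le) simp
qed simp

lemma (in hilbert_module) cauchy_schwarz_module: "cauchy_schwarz_module act ip"
  by unfold_locales (rule cauchy_schwarz_ineq)

section \<open>Absolute values and polar decompositions\<close>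

context cauchy_schwarz_module
begin

lemma op_positive_iff_pos: "op_positive ip A \<longleftrightarrow> pos A"
proof
  assume "op_positive ip A"
  then obtain B where "adjointable ip B" "A = adj ip B \<circ> B" unfolding op_positive_def by blast
  thus "pos A" using pos_adj_comp[OF adjp_adj] by (simp add: comp_def)
next
  assume A: "pos A"
  let ?B = "op_sqrt A"
  have B: "self_adjoint ?B" by (rule pos_self_adjoint[OF op_sqrt(1)[OF A]])
  have "A = adj ip ?B \<circ> ?B" using op_sqrt(2)[OF A] by (auto simp: adj_eqI[OF B])
  thus "op_positive ip A" unfolding op_positive_def using adjointableI[OF B] by blast
qed

lemma op_abs_eqI:
  assumes "adjp T T'" "pos C" "\<And>x. C (C x) = T' (T x)"
  shows "op_abs ip T = C"
  unfolding op_abs_def op_positive_iff_pos adj_eqI[OF assms(1)]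
proof (rule the_equality)
  show "pos C \<and> C \<circ> C = T' \<circ> T" using assms by auto
  show "A = C" if "pos A \<and> A \<circ> A = T' \<circ> T" for A
    using that assms by (intro pos_sqrt_unique) (auto dest: fun_cong)
qed

lemma op_abs:
  assumes T: "adjp T T'"
  shows "pos (op_abs ip T)" "op_abs ip T (op_abs ip T x) = T' (T x)"
proof -
  note P = pos_adj_comp[OF T]
  have "op_abs ip T = op_sqrt (\<lambda>x. T' (T x))"
    by (rule op_abs_eqI[OF T op_sqrt(1)[OF P] op_sqrt(2)[OF P]])
  thus "pos (op_abs ip T)" "op_abs ip T (op_abs ip T x) = T' (T x)"
    using op_sqrt[OF P] by simp_all
qed

lemma in_closure_range: "f x \<in> closure (range f)"
  by (rule closure_subset[THEN subsetD, OF rangeI])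

lemma adjp_closure_range:
  assumes Z: "adjp Z Z'" and M: "\<And>x. Z (M x) \<in> closure (range N)" and y: "y \<in> closure (range M)"
  shows "Z y \<in> closure (range N)"
proof -
  obtain K where K: "\<And>x. norm (Z x) \<le> K * norm x" using adjp_bounded[OF Z] by blast
  have "bounded_linear Z"
    by (rule bounded_linear_intro[of _ K])
      (use K in \<open>auto simp: adjp_linear[OF Z] mult.commute\<close>)
  hence "continuous_on (closure (range M)) Z" by (rule linear_continuous_on)
  hence "Z ` closure (range M) \<subseteq> closure (range N)"
    by (rule image_closure_subset[OF _ closed_closure]) (use M in auto)
  thus ?thesis using y by blast
qed

text \<open>The existence of such an \<open>R\<close> encodes that the closed range of \<open>M\<close> is complemented.\<close>

definition range_projection :: "('h \<Rightarrow> 'h) \<Rightarrow> ('h \<Rightarrow> 'h) \<Rightarrow> bool" where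
  "range_projection R M \<longleftrightarrow> self_adjoint R \<and> (\<forall>x. R (R x) = R x) \<and> (\<forall>x. R (M x) = M x) \<and>
     (\<forall>x. R x \<in> closure (range M))"

lemma range_projectionD:
  assumes "range_projection R M"
  shows "self_adjoint R" "R (R x) = R x" "R (M x) = M x" "R x \<in> closure (range M)"
  using assms unfolding range_projection_def by blast+

lemma eq_on_closure_range:
  assumes V: "adjp V V'" and W: "adjp W W'" and eq: "\<And>x. V (M x) = W (M x)"
    and y: "y \<in> closure (range M)"
  shows "V y = W y"
proof -
  have "V y - W y \<in> closure (range (\<lambda>_::'h. 0))"
    by (rule adjp_closure_range[OF adjp_diff[OF V W] _ y]) (simp add: eq)
  thus ?thesis by (simp add: image_constant_conv)
qed

lemma range_projection_fixes:
  "range_projection R M \<Longrightarrow> y \<in> closure (range M) \<Longrightarrow> R y = y"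
  by (rule eq_on_closure_range[OF range_projectionD(1) adjp_id range_projectionD(3)])

lemma range_projection_absorb:
  assumes R: "range_projection R M" and M: "self_adjoint M"
  shows "M (R x) = M x"
  using adjp_unique[OF adjp_comp[OF range_projectionD(1)[OF R] M]] M
  by (auto simp: range_projectionD(3)[OF R] dest: fun_cong)

text \<open>Both \<open>Z\<close> and \<open>Z\<^sup>*\<close> commute with \<open>M\<close> and so leave the closed range of \<open>M\<close> invariant.\<close>

lemma range_projection_commutes:
  assumes R: "range_projection R M" and M: "self_adjoint M" and Z: "adjp Z Z'"
    and comm: "\<And>x. Z (M x) = M (Z x)"
  shows "Z (R x) = R (Z x)"
proof -
  note saR = range_projectionD(1)[OF R]
  have inv: "R (Y (R x)) = Y (R x)" if Y: "adjp Y Y'" and "\<And>x. Y (M x) = M (Y x)" for Y Y' x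
  proof (rule range_projection_fixes[OF R])
    show "Y (R x) \<in> closure (range M)"
      by (rule adjp_closure_range[OF Y _ range_projectionD(4)[OF R]])
        (use that(2) in_closure_range[of M] in auto)
  qed
  have "Z' (M x) = M (Z' x)" for x
  proof (rule eq_if_ip_eq)
    fix z
    show "ip z (Z' (M x)) = ip z (M (Z' x))"
      by (simp add: adjpD[OF Z, symmetric] adjpD[OF M, symmetric] comm)
  qed
  from inv[OF adjp_sym[OF Z] this] have inv': "R (Z' (R y)) = Z' (R y)" for y .
  have "R (Z x) = R (Z (R x))"
  proof (rule eq_if_ip_eq)
    fix z
    have "ip z (R (Z (R x))) = ip (R (Z' (R z))) x"
      by (simp add: adjpD[OF saR] adjpD[OF adjp_sym[OF Z]])
    also have "\<dots> = ip z (R (Z x))"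
      by (simp add: inv' adjpD[OF saR] adjpD[OF adjp_sym[OF Z]])
    finally show "ip z (R (Z x)) = ip z (R (Z (R x)))" by simp
  qed
  thus ?thesis by (simp add: inv[OF Z comm])
qed

lemma range_projection_unique:
  assumes R: "range_projection R M" and Q: "range_projection Q M"
  shows "R = Q"
proof -
  have "R (Q x) = Q x" "Q (R x) = R x" for x
    using range_projection_fixes[OF R range_projectionD(4)[OF Q]]
      range_projection_fixes[OF Q range_projectionD(4)[OF R]] by auto
  thus ?thesis
    using adjp_unique[OF adjp_comp[OF range_projectionD(1)[OF R] range_projectionD(1)[OF Q]]]
      range_projectionD(1)[OF Q] by (auto dest: fun_cong)
qed

text \<open>The kernel of a self-adjoint operator is orthogonal to its closed range.\<close>

lemma range_projection_kernel:
  assumes R: "range_projection R M" and M: "self_adjoint M" and z: "M z = 0"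
  shows "R z = 0"
proof -
  have "closed {y. ip z y = 0}"
    by (intro closed_Collect_eq continuous_intros ip.continuous_on)
  moreover have "range M \<subseteq> {y. ip z y = 0}" using z by (auto simp: adjpD[OF M, symmetric])
  ultimately have "closure (range M) \<subseteq> {y. ip z y = 0}" by (rule closure_minimal[rotated])
  hence "ip z (R (R z)) = 0" using range_projectionD(2,4)[OF R] by auto
  thus ?thesis by (intro ip_definite) (simp add: adjpD[OF range_projectionD(1)[OF R]])
qed

lemma proj_onto_complemented:
  assumes M: "orth_complemented act ip M"
  shows "proj_onto ip M x \<in> M" "x - proj_onto ip M x \<in> ortho ip M"
    "x \<in> M \<Longrightarrow> proj_onto ip M x = x"
proof -
  have sub: "y - z \<in> M" if "y \<in> M" "z \<in> M" for y z
  proof -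
    have "y + cscale (-1) z \<in> M"
      using M that unfolding orth_complemented_def closed_submodule_def by blast
    thus ?thesis by (simp add: cscale_minus_left)
  qed
  have uniq: "y = z" if "y \<in> M" "x - y \<in> ortho ip M" "z \<in> M" "x - z \<in> ortho ip M" for x y z
  proof -
    have "(x - z) - (x - y) \<in> ortho ip M"
      using that unfolding ortho_def by (simp add: ip_diff_right)
    hence "y - z \<in> M \<inter> ortho ip M" using sub that by simp
    thus ?thesis using M unfolding orth_complemented_def by simp
  qed
  obtain y where y: "y \<in> M" "x - y \<in> ortho ip M"
    using M unfolding orth_complemented_def by (metis add_diff_cancel_left')
  have eq: "proj_onto ip M x = y" if "y \<in> M" "x - y \<in> ortho ip M" for x y
    unfolding proj_onto_def using that uniq by blast
  show "proj_onto ip M x \<in> M" "x - proj_onto ip M x \<in> ortho ip M"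
    using eq[OF y] y by auto
  show "x \<in> M \<Longrightarrow> proj_onto ip M x = x" by (rule eq) (auto simp: ortho_def)
qed

text \<open>A polar decomposition with all its data explicit: \<open>V'\<close> is the adjoint of \<open>V\<close>, and \<open>B\<close> turns out
  to be \<open>|T|\<close>. The projection is tied to the range of \<open>B\<close> instead of that of \<open>T\<^sup>*\<close>, so that the
  predicate can be verified without computing an absolute value first.\<close>

definition polar_factors ::
    "('h \<Rightarrow> 'h) \<Rightarrow> ('h \<Rightarrow> 'h) \<Rightarrow> ('h \<Rightarrow> 'h) \<Rightarrow> ('h \<Rightarrow> 'h) \<Rightarrow> bool" where
  "polar_factors T V V' B \<longleftrightarrow> adjp V V' \<and> pos B \<and> (\<forall>x. T x = V (B x)) \<and>
     range_projection (\<lambda>x. V' (V x)) B"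

lemma polar_factorsD:
  assumes "polar_factors T V V' B"
  shows "adjp V V'" "pos B" "T x = V (B x)" "range_projection (\<lambda>x. V' (V x)) B" "self_adjoint B"
  using assms pos_self_adjoint unfolding polar_factors_def by blast+

lemma polar_factors_adjp: "polar_factors T V V' B \<Longrightarrow> adjp T (\<lambda>x. B (V' x))"
  using adjp_comp[OF polar_factorsD(1,5)] polar_factorsD(3) unfolding adjp_def by metis

lemma polar_factors_op_abs:
  assumes "polar_factors T V V' B" shows "op_abs ip T = B"
proof (rule op_abs_eqI[OF polar_factors_adjp[OF assms]])
  note P = polar_factorsD[OF assms]
  show "pos B" by (rule P)
  show "B (B x) = B (V' (T x))" for x using range_projectionD(3)[OF P(4)] by (simp add: P(3))
qed

text \<open>If \<open>T = V |T|\<close> then \<open>T\<^sup>* = |T| V\<^sup>*\<close>, and \<open>|T| = T\<^sup>* V\<close> once \<open>V\<^sup>* V\<close> fixes the range of \<open>|T|\<close>. So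
  \<open>T\<^sup>*\<close> and \<open>|T|\<close> have the same range.\<close>

lemma polar_decomposition_iff:
  assumes T: "adjp T T'"
  shows "polar_decomposition act ip T V \<longleftrightarrow> polar_factors T V (adj ip V) (op_abs ip T)"
proof
  assume pd: "polar_decomposition act ip T V"
  let ?B = "op_abs ip T" and ?V' = "adj ip V" and ?M = "closure (range T')"
  let ?R = "\<lambda>x. ?V' (V x)"
  have V: "adjp V ?V'"
    using pd adjp_adj unfolding polar_decomposition_def partial_isometry_def by blast
  have TVB: "T x = V (?B x)" for x
    using pd unfolding polar_decomposition_def by (metis comp_apply)
  have compl: "orth_complemented act ip ?M" and R: "?R x = proj_onto ip ?M x" for x
    using pd unfolding polar_decomposition_def adj_eqI[OF T] by (auto simp: fun_eq_iff)
  have saR: "self_adjoint ?R" by (rule adjp_comp[OF adjp_sym[OF V] V])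
  have RT': "?R (T' x) = T' x" for x
    unfolding R by (rule proj_onto_complemented(3)[OF compl]) (rule in_closure_range)
  have TR: "T (?R x) = T x" for x
    using adjp_unique[OF adjp_comp[OF saR adjp_sym[OF T]]] adjp_sym[OF T] RT' by (auto dest: fun_cong)
  note B = op_abs[OF T] pos_self_adjoint[OF op_abs(1)[OF T]]
  have BR: "?B (?R x) = ?B x" for x
  proof -
    have D: "adjp (\<lambda>x. ?B (?R x) - ?B x) (\<lambda>x. ?R (?B x) - ?B x)"
      by (rule adjp_diff[OF adjp_comp[OF B(3) saR] B(3)])
    have "?B (?B (?R x) - ?B x) = 0" by (simp add: adjp_linear[OF B(3)] B(2) TR)
    hence "?B (?R x) - ?B x = 0"
      using zero_if_adj_comp_zero[OF D, of x] adjp_map_zero[OF saR] by simp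
    thus ?thesis by simp
  qed
  have RB: "?R (?B x) = ?B x" for x
    using adjp_unique[OF adjp_comp[OF B(3) saR]] B(3) BR by (auto dest: fun_cong)
  have T'eq: "T' = (\<lambda>x. ?B (?V' x))"
    by (rule adjp_unique[OF T]) (use adjp_comp[OF V B(3)] TVB in \<open>simp add: adjp_def\<close>)
  have "range T' = range ?B"
  proof
    show "range ?B \<subseteq> range T'" unfolding T'eq using BR by (metis image_subsetI rangeI)
  qed (auto simp: T'eq)
  hence "?R x \<in> closure (range ?B)" for x
    unfolding R using proj_onto_complemented(1)[OF compl] by simp
  moreover have "?R (?R x) = ?R x" for x
    using R proj_onto_complemented(1,3)[OF compl] by metis
  ultimately show "polar_factors T V ?V' ?B"
    unfolding polar_factors_def range_projection_def using V B TVB saR RB by blast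
next
  let ?B = "op_abs ip T" and ?V' = "adj ip V" and ?M = "closure (range T')"
  let ?R = "\<lambda>x. ?V' (V x)"
  assume pf: "polar_factors T V ?V' ?B"
  note P = polar_factorsD[OF pf] and Q = range_projectionD[OF polar_factorsD(4)[OF pf]]
  have T'eq: "T' = (\<lambda>x. ?B (?V' x))" by (rule adjp_unique[OF T polar_factors_adjp[OF pf]])
  have "range T' = range ?B"
  proof
    have "?B x \<in> range T'" for x
      using range_projection_absorb[OF P(4,5), of x] unfolding T'eq by (metis rangeI)
    thus "range ?B \<subseteq> range T'" by blast
  qed (auto simp: T'eq)
  hence M: "?M = {x. ?R x = x}"
    using range_projection_fixes[OF P(4)] Q(4) by (auto, metis)
  have ortho: "x - ?R x \<in> ortho ip ?M" for x
    unfolding ortho_def M using adjpD[OF Q(1)] by (auto simp: ip_diff_right) metis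
  have compl: "orth_complemented act ip ?M"
    unfolding orth_complemented_def closed_submodule_def
  proof (intro conjI ballI allI)
    show "closed ?M" by (rule closed_closure)
    show "\<exists>y\<in>?M. \<exists>z\<in>ortho ip ?M. x = y + z" for x
      using ortho[of x] Q(2)[of x] by (intro bexI[of _ "?R x"] bexI[of _ "x - ?R x"]) (auto simp: M)
    show "?M \<inter> ortho ip ?M = {0}"
      using adjp_map_zero[OF Q(1)] by (auto simp: M ortho_def intro: ip_definite)
  qed (auto simp: M adjp_linear[OF Q(1)] adjp_map_act[OF Q(1)])
  have "?R x = proj_onto ip ?M x" for x
    unfolding proj_onto_def
  proof (rule the_equality[symmetric])
    show "?R x \<in> ?M \<and> x - ?R x \<in> ortho ip ?M" using ortho Q(2) by (simp add: M)
    fix y assume y: "y \<in> ?M \<and> x - y \<in> ortho ip ?M"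
    hence "?R x - y \<in> ?M" using Q(2) by (simp add: M adjp_linear[OF Q(1)])
    moreover have "?R x - y \<in> ortho ip ?M"
      using y ortho[of x] unfolding ortho_def by (auto simp: ip_diff_right)
    ultimately have "?R x - y \<in> {0}" using compl unfolding orth_complemented_def by blast
    thus "y = ?R x" by simp
  qed
  moreover have "op_projection ip (?V' \<circ> V)"
    unfolding op_projection_def comp_def using adj_eqI[OF Q(1)] adjointableI[OF Q(1)] Q(2) by auto
  ultimately show "polar_decomposition act ip T V"
    unfolding polar_decomposition_def partial_isometry_def adj_eqI[OF T]
    using compl adjointableI[OF P(1)] P(3) by (auto simp: fun_eq_iff)
qed

text \<open>For \<open>D = V V\<^sup>* V - V\<close> one has \<open>V\<^sup>* D = 0\<close> because \<open>V\<^sup>* V\<close> is idempotent, and hence \<open>D\<^sup>* D = 0\<close>.\<close>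

lemma partial_isometry_absorb:
  assumes V: "adjp V V'" and R: "range_projection (\<lambda>x. V' (V x)) B"
  shows "V (V' (V x)) = V x" "V' (V (V' x)) = V' x"
proof -
  have absorb: "V (V' (V x)) = V x" for x
  proof -
    have D: "adjp (\<lambda>x. V (V' (V x)) - V x) (\<lambda>x. V' (V (V' x)) - V' x)"
      by (rule adjp_diff[OF adjp_comp[OF V adjp_comp[OF adjp_sym[OF V] V]] V])
    have "V' (V (V' (V x)) - V x) = 0"
      using range_projectionD(2)[OF R, of x] by (simp add: adjp_linear[OF adjp_sym[OF V]])
    thus ?thesis
      using zero_if_adj_comp_zero[OF D, of x] adjp_map_zero[OF V] adjp_map_zero[OF adjp_sym[OF V]]
      by simp
  qed
  show "V (V' (V x)) = V x" by (rule absorb)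
  show "V' (V (V' x)) = V' x"
    using adjp_unique[OF adjp_comp[OF V adjp_comp[OF adjp_sym[OF V] V]]] V absorb
    by (auto dest: fun_cong)
qed

lemma polar_factors_unique:
  assumes V: "polar_factors T V V' B" and W: "polar_factors T W W' B"
  shows "V = W"
proof
  fix x
  note P = polar_factorsD[OF V] and Q = polar_factorsD[OF W]
  define R where "R x = V' (V x)" for x
  have R: "range_projection R B" using P(4) unfolding R_def .
  have RW: "R = (\<lambda>x. W' (W x))" by (rule range_projection_unique[OF R Q(4)])
  have "V (R x) = W (R x)"
    by (rule eq_on_closure_range[OF P(1) Q(1) _ range_projectionD(4)[OF R]])
      (simp flip: P(3) Q(3))
  moreover have "V (R x) = V x" unfolding R_def by (rule partial_isometry_absorb(1)[OF P(1,4)])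
  moreover have "W (R x) = W x" unfolding RW by (rule partial_isometry_absorb(1)[OF Q(1,4)])
  ultimately show "V x = W x" by simp
qed

end

section \<open>The polar decomposition of a product\<close>

context cauchy_schwarz_module
begin

text \<open>The operator \<open>G = V |S| V\<^sup>*\<close> is \<open>|S\<^sup>*|\<close>, and \<open>V V\<^sup>*\<close> projects onto its closed range.\<close>

lemma polar_factors_range:
  assumes pf: "polar_factors S V V' B"
  defines "G \<equiv> \<lambda>x. V (B (V' x))"
  shows "pos G" "range_projection (\<lambda>x. V (V' x)) G" "G (V x) = V (B x)"
proof -
  note P = polar_factorsD[OF pf] and R = range_projectionD[OF polar_factorsD(4)[OF pf]]
  note abs = partial_isometry_absorb[OF P(1,4)]
  show "pos G" unfolding G_def by (rule pos_conj[OF P(2) adjp_sym[OF P(1)]])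
  have GV: "G (V x) = V (B x)" for x
    using range_projection_absorb[OF P(4,5)] by (simp add: G_def)
  show "G (V x) = V (B x)" by (rule GV)
  have "V (V' x) \<in> closure (range G)" for x
  proof (rule adjp_closure_range[OF P(1)])
    show "V (B x) \<in> closure (range G)" for x using in_closure_range[of G "V x"] by (simp add: GV)
    show "V' x \<in> closure (range B)" using R(4)[of "V' x"] by (simp add: abs)
  qed
  thus "range_projection (\<lambda>x. V (V' x)) G"
    unfolding range_projection_def using adjp_comp[OF P(1) adjp_sym[OF P(1)]] abs
    by (simp add: G_def)
qed

text \<open>The absolute value of \<open>T S\<close> is \<open>C = V\<^sup>* A G V\<close>. It is positive because
  \<open>A G = A\<^bsup>1/2\<^esup> G A\<^bsup>1/2\<^esup>\<close>. As \<open>A\<close> and \<open>G\<close> commute, so do their range projections \<open>Q = U\<^sup>* U\<close> and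
  \<open>E = V V\<^sup>*\<close>, which makes \<open>(U V)\<^sup>* (U V) = V\<^sup>* Q V\<close> a projection; its range is the closed range
  of \<open>C\<close> because \<open>E Q\<close> maps into the closed range of \<open>A G\<close>.\<close>

lemma polar_factors_comp:
  assumes S: "polar_factors S V V' B" and T: "polar_factors T U U' A"
    and comm: "\<And>x. A (V (B (V' x))) = V (B (V' (A x)))"
  obtains C where "polar_factors (\<lambda>x. T (S x)) (\<lambda>x. U (V x)) (\<lambda>x. V' (U' x)) C"
    "\<And>x. U (V (C (V' (U' x)))) = U (A (V (B (V' (U' x)))))"
proof -
  define G where "G x = V (B (V' x))" for x
  define E where "E x = V (V' x)" for x
  define Q where "Q x = U' (U x)" for x
  note P = polar_factorsD[OF S] and P' = polar_factorsD[OF T]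
  note absV = partial_isometry_absorb[OF P(1,4)] and absU = partial_isometry_absorb[OF P'(1,4)]
  have G: "pos G" and EG: "range_projection E G" and GV: "G (V x) = V (B x)" for x
    using polar_factors_range[OF S] unfolding G_def E_def by auto
  note saG = pos_self_adjoint[OF G]
  have QA: "range_projection Q A" using P'(4) unfolding Q_def .
  have AG: "A (G x) = G (A x)" for x using comm by (simp add: G_def)
  have AE: "A (E x) = E (A x)" for x by (rule range_projection_commutes[OF EG saG P'(5) AG])
  have GQ: "G (Q x) = Q (G x)" for x
    by (rule range_projection_commutes[OF QA P'(5) saG]) (simp add: AG)
  have EQ: "E (Q x) = Q (E x)" for x
    by (rule range_projection_commutes[OF QA P'(5) range_projectionD(1)[OF EG]]) (simp add: AE)
  have V'E: "V' (E x) = V' x" and EV: "E (V x) = V x" for x by (simp_all add: E_def absV)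
  have GE: "G (E x) = G x" for x by (rule range_projection_absorb[OF EG saG])
  note EG' = range_projectionD[OF EG] and QA' = range_projectionD[OF QA]
  define C where "C x = V' (A (G (V x)))" for x
  have VC: "V (C x) = A (G (V x))" for x
    using AE[of "G (V x)"] EG'(3) by (simp add: C_def E_def)
  define K where "K = op_sqrt A"
  note K = op_sqrt[OF P'(2), folded K_def]
  have "G (K x) = K (G x)" for x by (rule K(3)[OF saG]) (simp add: AG)
  hence CK: "C x = V' (K (G (K (V x))))" for x by (simp add: C_def flip: K(2))
  have posC: "pos C"
    using pos_conj[OF pos_conj[OF G pos_self_adjoint[OF K(1)]] P(1)] unfolding CK[abs_def] .
  have "range_projection (\<lambda>x. V' (U' (U (V x)))) C"
    unfolding range_projection_def Q_def[symmetric]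
  proof (intro conjI allI)
    show "self_adjoint (\<lambda>x. V' (Q (V x)))"
      by (rule adjp_comp[OF adjp_sym[OF P(1)] adjp_comp[OF QA'(1) P(1)]])
    show "V' (Q (V (V' (Q (V x))))) = V' (Q (V x))" for x
    proof -
      have "V' (Q (E (Q (V x)))) = V' (E (Q (Q (V x))))" by (simp add: EQ)
      thus ?thesis by (simp add: V'E QA'(2)) (simp add: E_def)
    qed
    show "V' (Q (V (C x))) = C x" for x by (simp add: VC QA'(3)) (simp add: C_def)
    show "V' (Q (V x)) \<in> closure (range C)" for x
    proof -
      have A_E: "A (E y) \<in> closure (range (\<lambda>w. A (G w)))" for y
        by (rule adjp_closure_range[OF P'(5) _ EG'(4)]) (rule in_closure_range)
      have "E (Q (V x)) \<in> closure (range (\<lambda>w. A (G w)))"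
        by (rule adjp_closure_range[OF EG'(1) _ QA'(4)]) (simp add: A_E flip: AE)
      hence "Q (V x) \<in> closure (range (\<lambda>w. A (G w)))" by (simp add: EQ EV)
      moreover have "V' (A (G w)) \<in> closure (range C)" for w
        using in_closure_range[of C "V' w"] GE[of w] by (simp add: C_def E_def)
      ultimately show ?thesis by (rule adjp_closure_range[OF adjp_sym[OF P(1)], rotated])
    qed
  qed
  moreover have "T (S x) = U (V (C x))" for x by (simp add: P(3) P'(3) VC GV)
  ultimately have "polar_factors (\<lambda>x. T (S x)) (\<lambda>x. U (V x)) (\<lambda>x. V' (U' x)) C"
    unfolding polar_factors_def using posC adjp_comp[OF P'(1) P(1)] by blast
  moreover have "U (V (C (V' (U' x)))) = U (A (V (B (V' (U' x)))))" for x
    using GE[of "U' x"] by (simp add: VC) (simp add: G_def E_def)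
  ultimately show ?thesis using that by blast
qed

text \<open>That \<open>V\<^sup>* Q V\<close> is idempotent means \<open>E Q V = Q V\<close>. Cancelling \<open>U\<close> in \<open>U A V |S| = U V C\<close> then
  leaves \<open>A V |S| = V C\<close>, so \<open>A G = V C V\<^sup>*\<close> is self-adjoint.\<close>

lemma polar_factors_comp_converse:
  assumes S: "polar_factors S V V' B" and T: "polar_factors T U U' A"
    and TS: "polar_factors (\<lambda>x. T (S x)) (\<lambda>x. U (V x)) (\<lambda>x. V' (U' x)) C"
  shows "A (V (B (V' x))) = V (B (V' (A x)))"
proof -
  define E where "E x = V (V' x)" for x
  define Q where "Q x = U' (U x)" for x
  note P = polar_factorsD[OF S] and P' = polar_factorsD[OF T] and PC = polar_factorsD[OF TS]
  note absV = partial_isometry_absorb[OF P(1,4)]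
  note EG = range_projectionD[OF polar_factors_range(2)[OF S], folded E_def]
  note QA = range_projectionD[OF P'(4), folded Q_def]
  note FC = range_projectionD[OF PC(4), folded Q_def]
  have V'E: "V' (E x) = V' x" for x by (simp add: E_def absV)
  have EQV: "E (Q (V x)) = Q (V x)" for x
  proof -
    have D: "adjp (\<lambda>x. Q (V x) - E (Q (V x))) (\<lambda>x. V' (Q x) - V' (Q (E x)))"
      by (rule adjp_diff[OF adjp_comp[OF QA(1) P(1)] adjp_comp[OF EG(1) adjp_comp[OF QA(1) P(1)]]])
    let ?d = "Q (V x) - E (Q (V x))"
    have "E ?d = 0" by (simp add: adjp_linear[OF EG(1)] EG(2))
    moreover have "V' (Q ?d) = 0"
      using FC(2)[of x] by (simp add: adjp_linear[OF QA(1)] adjp_linear[OF adjp_sym[OF P(1)]] QA(2))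
        (simp add: E_def)
    ultimately have "?d = 0"
      using zero_if_adj_comp_zero[OF D, of x] adjp_map_zero[OF QA(1)]
        adjp_map_zero[OF adjp_sym[OF P(1)]] by simp
    thus ?thesis by simp
  qed
  have AG: "A (V (B (V' x))) = V (C (V' x))" for x
  proof -
    have "U (A (V (B y))) = U (V (C y))" for y using PC(3)[of y] by (simp add: P(3) P'(3))
    hence "Q (A (V (B y))) = Q (V (C y))" for y by (simp add: Q_def)
    hence 1: "A (V (B y)) = Q (V (C y))" for y by (simp add: QA(3))
    have "V (C y) = E (Q (V (C y)))" for y using FC(3)[of y] by (simp add: E_def)
    thus ?thesis using 1 by (simp add: EQV)
  qed
  have "self_adjoint (\<lambda>x. A (V (B (V' x))))"
    unfolding AG by (rule adjp_comp[OF P(1) adjp_comp[OF PC(5) adjp_sym[OF P(1)]]])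
  moreover have "adjp (\<lambda>x. A (V (B (V' x)))) (\<lambda>x. V (B (V' (A x))))"
    by (rule adjp_comp[OF P'(5) pos_self_adjoint[OF polar_factors_range(1)[OF S]]])
  ultimately show ?thesis using adjp_unique by (metis (mono_tags))
qed

section \<open>Polar decompositions of powers\<close>

text \<open>The products \<open>A\<^sub>1 A\<^sub>2 \<dots> A\<^sub>k\<close> of \<open>A\<^sub>j = U\<^sup>j A (U\<^sup>*)\<^sup>j\<close>. In the centered situation they are
  the absolute values of \<open>(T\<^sup>*)\<^sup>k\<close>.\<close>

definition conj_pow :: "('h \<Rightarrow> 'h) \<Rightarrow> ('h \<Rightarrow> 'h) \<Rightarrow> ('h \<Rightarrow> 'h) \<Rightarrow> nat \<Rightarrow> 'h \<Rightarrow> 'h" where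
  "conj_pow U U' A k x = (U ^^ k) (A ((U' ^^ k) x))"

primrec conj_prod :: "('h \<Rightarrow> 'h) \<Rightarrow> ('h \<Rightarrow> 'h) \<Rightarrow> ('h \<Rightarrow> 'h) \<Rightarrow> nat \<Rightarrow> 'h \<Rightarrow> 'h" where
  "conj_prod U U' A 0 = (\<lambda>x. x)"
| "conj_prod U U' A (Suc k) = (\<lambda>x. conj_prod U U' A k (conj_pow U U' A (Suc k) x))"

lemma conj_pow_Suc: "conj_pow U U' A (Suc k) x = U (conj_pow U U' A k (U' x))"
  by (simp add: conj_pow_def funpow_swap1)

lemma adjp_conj_pow:
  "adjp U U' \<Longrightarrow> self_adjoint A \<Longrightarrow> self_adjoint (conj_pow U U' A k)"
  using adjp_comp[OF adjp_funpow adjp_comp[OF _ adjp_funpow[OF adjp_sym]]]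
  unfolding conj_pow_def[abs_def] by blast

lemma conj_prod_commutes:
  assumes "\<And>j x. j \<in> {1..k} \<Longrightarrow> A (conj_pow U U' A j x) = conj_pow U U' A j (A x)"
  shows "A (conj_prod U U' A k x) = conj_prod U U' A k (A x)"
  using assms by (induction k arbitrary: x) auto

text \<open>Moving the last factor out: \<open>A\<^bsub>k+1\<^esub>\<close> commutes with \<open>A\<close> and hence with \<open>U\<^sup>* U\<close>, so
  \<open>A\<^bsub>k+1\<^esub> U\<^sup>* = U\<^sup>* U A\<^bsub>k+1\<^esub> U\<^sup>* = U\<^sup>* A\<^bsub>k+2\<^esub>\<close>.\<close>

lemma conj_prod_shift:
  assumes T: "polar_factors T U U' A"
    and comm: "\<And>j x. j \<in> {1..k} \<Longrightarrow> A (conj_pow U U' A j x) = conj_pow U U' A j (A x)"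
  shows "U (A (conj_prod U U' A k (U' x))) = conj_prod U U' A (Suc k) x"
  using comm
proof (induction k arbitrary: x)
  case 0
  show ?case by (simp add: conj_pow_def)
next
  case (Suc k)
  note P = polar_factorsD[OF T]
  let ?Ak = "conj_pow U U' A (Suc k)"
  have "U' (U (?Ak (U' x))) = ?Ak (U' x)"
  proof -
    have "?Ak (U' (U (U' x))) = U' (U (?Ak (U' x)))"
      by (rule range_projection_commutes[OF P(4,5) adjp_conj_pow[OF P(1,5)]])
        (use Suc.prems in simp)
    thus ?thesis by (simp add: partial_isometry_absorb(2)[OF P(1,4)])
  qed
  hence "U (A (conj_prod U U' A (Suc k) (U' x)))
      = U (A (conj_prod U U' A k (U' (conj_pow U U' A (Suc (Suc k)) x))))"
    by (simp add: conj_pow_Suc[of U U' A "Suc k"])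
  also have "\<dots> = conj_prod U U' A (Suc k) (conj_pow U U' A (Suc (Suc k)) x)"
    by (rule Suc.IH) (use Suc.prems in auto)
  finally show ?case by simp
qed

lemma polar_factors_funpow_step:
  assumes S: "polar_factors (T ^^ k) (U ^^ k) (U' ^^ k) B" and T: "polar_factors T U U' A"
    and G: "\<And>x. (U ^^ k) (B ((U' ^^ k) x)) = conj_prod U U' A k x"
    and comm: "\<And>j x. j \<in> {1..k} \<Longrightarrow> A (conj_pow U U' A j x) = conj_pow U U' A j (A x)"
  obtains C where "polar_factors (T ^^ Suc k) (U ^^ Suc k) (U' ^^ Suc k) C"
    "\<And>x. (U ^^ Suc k) (C ((U' ^^ Suc k) x)) = conj_prod U U' A (Suc k) x"
proof -
  have eq: "(\<lambda>x. f ((f ^^ k) x)) = f ^^ Suc k" "(\<lambda>x. (f ^^ k) (f x)) = f ^^ Suc k" for f :: "'h \<Rightarrow> 'h"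
    by (auto simp: funpow_swap1)
  obtain C where C: "polar_factors (\<lambda>x. T ((T ^^ k) x)) (\<lambda>x. U ((U ^^ k) x)) (\<lambda>x. (U' ^^ k) (U' x)) C"
    "\<And>x. U ((U ^^ k) (C ((U' ^^ k) (U' x)))) = U (A ((U ^^ k) (B ((U' ^^ k) (U' x)))))"
    by (rule polar_factors_comp[OF S T]) (use conj_prod_commutes[OF comm] in \<open>auto simp: G\<close>)
  have "(U ^^ Suc k) (C ((U' ^^ Suc k) x)) = conj_prod U U' A (Suc k) x" for x
    using C(2)[of x] conj_prod_shift[OF T comm] by (simp add: G funpow_swap1)
  thus ?thesis using that C(1)[unfolded eq] by blast
qed

lemma polar_factors_funpow:
  assumes T: "polar_factors T U U' A"
    and comm: "\<And>j x. j \<in> {1..n} \<Longrightarrow> A (conj_pow U U' A j x) = conj_pow U U' A j (A x)"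
    and k: "1 \<le> k" "k \<le> Suc n"
  shows "\<exists>B. polar_factors (T ^^ k) (U ^^ k) (U' ^^ k) B \<and>
    (\<forall>x. (U ^^ k) (B ((U' ^^ k) x)) = conj_prod U U' A k x)"
  using k
proof (induction k rule: dec_induct)
  case base
  have one: "f ^^ 1 = f" for f :: "'h \<Rightarrow> 'h" by (simp add: fun_eq_iff)
  show ?case using T unfolding one by (auto simp: conj_pow_def)
next
  case (step k)
  then obtain B where B: "polar_factors (T ^^ k) (U ^^ k) (U' ^^ k) B"
    "\<And>x. (U ^^ k) (B ((U' ^^ k) x)) = conj_prod U U' A k x" by auto
  have "A (conj_pow U U' A j x) = conj_pow U U' A j (A x)" if "j \<in> {1..k}" for j x
    using that step.prems comm by auto
  from polar_factors_funpow_step[OF B(1) T B(2) this] show ?case by metis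
qed

text \<open>Let \<open>k = m + 1\<close> and let \<open>G\<^sub>m\<close>, \<open>G\<^sub>k = G\<^sub>m A\<^sub>k\<close> be the products of the preceding definition. By
  induction \<open>A\<close> commutes with \<open>G\<^sub>m\<close>, and by the converse on products with \<open>G\<^sub>k\<close>; hence
  \<open>G\<^sub>m [A, A\<^sub>k] = 0\<close>. The projection \<open>E = U\<^sup>m (U\<^sup>*)\<^sup>m\<close> onto the closed range of \<open>G\<^sub>m\<close> fixes \<open>A\<^sub>k\<close> from
  the left and commutes with \<open>A\<close>, so it fixes the commutator, and it vanishes on the kernel of
  \<open>G\<^sub>m\<close>.\<close>

lemma conj_pow_commutes:
  assumes T: "polar_factors T U U' A"
    and pf: "\<And>k. k \<in> {1..Suc n} \<Longrightarrow> polar_factors (T ^^ k) (U ^^ k) (U' ^^ k) (P k)"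
  shows "k \<in> {1..n} \<Longrightarrow> A (conj_pow U U' A k x) = conj_pow U U' A k (A x)"
proof (induction k arbitrary: x rule: less_induct)
  case (less k)
  then obtain m where k: "k = Suc m" by (cases k) auto
  have comm: "A (conj_pow U U' A j x) = conj_pow U U' A j (A x)" if "j \<in> {1..m}" for j x
    using less that k by auto
  note PA = polar_factorsD[OF T]
  let ?Ak = "conj_pow U U' A k" and ?G = "conj_prod U U' A"
  have G: "(U ^^ j) (P j ((U' ^^ j) x)) = ?G j x" if j: "1 \<le> j" "j \<le> k" for j x
  proof -
    obtain B where B: "polar_factors (T ^^ j) (U ^^ j) (U' ^^ j) B"
      "(U ^^ j) (B ((U' ^^ j) x)) = ?G j x" for x
      using polar_factors_funpow[OF T comm j[unfolded k]] by auto
    moreover have "P j = B"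
      using polar_factors_op_abs[OF B(1)] polar_factors_op_abs[OF pf[of j]] j less.prems by simp
    ultimately show ?thesis by simp
  qed
  have AGm: "A (?G m x) = ?G m (A x)" for x by (rule conj_prod_commutes[OF comm])
  have AGk: "A (?G k x) = ?G k (A x)" for x
  proof -
    have eq: "(\<lambda>x. f ((f ^^ k) x)) = f ^^ Suc k" "(\<lambda>x. (f ^^ k) (f x)) = f ^^ Suc k" for f :: "'h \<Rightarrow> 'h"
      by (auto simp: funpow_swap1)
    have "polar_factors (T ^^ k) (U ^^ k) (U' ^^ k) (P k)" using pf less.prems by simp
    from polar_factors_comp_converse[OF this T, unfolded eq, OF pf[of "Suc k"]] less.prems
    show ?thesis by (simp add: G)
  qed
  define Z where "Z x = A (?Ak x) - ?Ak (A x)" for x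
  show ?case
  proof (cases "m = 0")
    case True
    thus ?thesis using AGk[of x] by (simp add: k)
  next
    case False
    define E where "E x = (U ^^ m) ((U' ^^ m) x)" for x
    have pfm: "polar_factors (T ^^ m) (U ^^ m) (U' ^^ m) (P m)" using pf less.prems False k by simp
    have Gm: "(\<lambda>x. (U ^^ m) (P m ((U' ^^ m) x))) = ?G m" using G[of m] False k by auto
    note R = polar_factors_range(1,2)[OF pfm, folded E_def, unfolded Gm]
    note saG = pos_self_adjoint[OF R(1)]
    have Em: "E ((U ^^ m) x) = (U ^^ m) x" for x
      unfolding E_def by (rule partial_isometry_absorb(1)[OF polar_factorsD(1,4)[OF pfm]])
    have EAk: "E (?Ak x) = ?Ak x" for x
      using Em by (simp add: conj_pow_def k funpow_swap1)
    have EA: "A (E x) = E (A x)" for x by (rule range_projection_commutes[OF R(2) saG PA(5) AGm])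
    have "?G m (Z x) = 0"
      using AGk[of x] by (simp add: Z_def k adjp_linear[OF saG] AGm)
    hence "E (Z x) = 0" by (rule range_projection_kernel[OF R(2) saG])
    moreover have "E (Z x) = Z x"
      by (simp add: Z_def adjp_linear[OF range_projectionD(1)[OF R(2)]] EAk flip: EA)
    ultimately show ?thesis by (simp add: Z_def)
  qed
qed

end

theorem theorem4p3:
  fixes act :: "'h::complex_banach \<Rightarrow> 'a::cstar_algebra \<Rightarrow> 'h"
    and ip :: "'h \<Rightarrow> 'h \<Rightarrow> 'a"
    and T U :: "'h \<Rightarrow> 'h"
    and n :: nat
  assumes "hilbert_module act ip"
    and "adjointable ip T"
    and "polar_decomposition act ip T U"
    and "n \<ge> 1"
  shows "n_centered act ip (n + 1) T \<longleftrightarrow>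
    (\<forall>k\<in>{1..n}.
       commutator (U ^^ k \<circ> op_abs ip T \<circ> adj ip (U ^^ k)) (op_abs ip T) = (\<lambda>x. 0))"
proof -
  interpret cauchy_schwarz_module act ip
    by (rule hilbert_module.cauchy_schwarz_module[OF assms(1)])
  define A where "A = op_abs ip T"
  define U' where "U' = adj ip U"
  have T: "adjp T (adj ip T)" by (rule adjp_adj[OF assms(2)])
  have pf: "polar_factors T U U' A"
    using assms(3) unfolding polar_decomposition_iff[OF T] A_def U'_def .
  note P = polar_factorsD[OF pf]
  have adjU: "adj ip (U ^^ k) = U' ^^ k" for k by (rule adj_eqI[OF adjp_funpow[OF P(1)]])
  have power: "polar_decomposition act ip (T ^^ k) (U ^^ k) \<longleftrightarrow>
      polar_factors (T ^^ k) (U ^^ k) (U' ^^ k) (op_abs ip (T ^^ k))" for k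
    using polar_decomposition_iff[OF adjp_funpow[OF T]] by (simp add: adjU)
  have unique: "W = U" if "polar_decomposition act ip T W" for W
    using that pf polar_factors_unique unfolding polar_decomposition_iff[OF T] A_def by blast
  have comm: "commutator (U ^^ k \<circ> op_abs ip T \<circ> adj ip (U ^^ k)) (op_abs ip T) = (\<lambda>x. 0) \<longleftrightarrow>
      (\<forall>x. A (conj_pow U U' A k x) = conj_pow U U' A k (A x))" for k
    by (auto simp: commutator_def fun_eq_iff adjU conj_pow_def A_def)
  have "n_centered act ip (n + 1) T \<longleftrightarrow>
      (\<forall>k\<in>{1..Suc n}. polar_factors (T ^^ k) (U ^^ k) (U' ^^ k) (op_abs ip (T ^^ k)))"
  proof -
    have "n_centered act ip (n + 1) T \<longleftrightarrow>
        (\<forall>k\<in>{1..n + 1}. polar_decomposition act ip (T ^^ k) (U ^^ k))"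
      unfolding n_centered_def using assms(3) unique by metis
    thus ?thesis by (simp only: power Suc_eq_plus1)
  qed
  also have "\<dots> \<longleftrightarrow> (\<forall>k\<in>{1..n}. \<forall>x. A (conj_pow U U' A k x) = conj_pow U U' A k (A x))"
  proof
    assume "\<forall>k\<in>{1..Suc n}. polar_factors (T ^^ k) (U ^^ k) (U' ^^ k) (op_abs ip (T ^^ k))"
    thus "\<forall>k\<in>{1..n}. \<forall>x. A (conj_pow U U' A k x) = conj_pow U U' A k (A x)"
      using conj_pow_commutes[OF pf, of n "\<lambda>k. op_abs ip (T ^^ k)"] by blast
  next
    assume c: "\<forall>k\<in>{1..n}. \<forall>x. A (conj_pow U U' A k x) = conj_pow U U' A k (A x)"
    show "\<forall>k\<in>{1..Suc n}. polar_factors (T ^^ k) (U ^^ k) (U' ^^ k) (op_abs ip (T ^^ k))"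
    proof
      fix k assume "k \<in> {1..Suc n}"
      then obtain B where B: "polar_factors (T ^^ k) (U ^^ k) (U' ^^ k) B"
        using polar_factors_funpow[OF pf, of n k] c by auto
      with polar_factors_op_abs[OF B]
      show "polar_factors (T ^^ k) (U ^^ k) (U' ^^ k) (op_abs ip (T ^^ k))" by simp
    qed
  qed
  finally show ?thesis unfolding comm .
qed

end
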